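(* The system $\dot z(t)-iAz(t)=0$ $(t>0)$, $y(t)=Cz(t)$, $z(0)=z_0$ is weakly observable if and only if $C$ is spectrally coercive; that is, the following two assertions are equivalent. (i) There exist functions $\varepsilon,\Psi\in\Sigma_d$ such that if $z\in D(A)\setminus\{0\}$ satisfies $$\frac{\lVert Az\rVert_X^2}{\lVert z\rVert_X^2}-\lambda_A^2(z)\le\varepsilon(\lambda_{|A|}(z)),$$ then $$\lVert Cz\rVert_Y^2\ge\Psi(\lambda_{|A|}(z))\lVert z\rVert_X^2.$$ (ii) The following weak observability inequality holds, with $z(t)=e^{itA}z_0$: $$\theta_2\,\Psi\Big(\theta_0\Big(\frac1T+\lambda_{|A|}(z_0)\Big)\Big)\lVert z_0\rVert_X^2\le\int_0^T\lVert Cz(t)\rVert_Y^2\,dt,\qquad\forall z_0\in D(A)\setminus\{0\},$$ for all $T\ge\mathtt T(\lambda_{|A|}(z_0))$, where, for given $\lambda\ge0$, $\mathtt T(\lambda)$ is the unique solution $T>0$ of the equation $$T\,\varepsilon\Big(\theta_0\Big(\frac1T+\lambda\Big)\Big)=\theta_1,$$ $\varepsilon,\Psi\in\Sigma_d$ (these being, for the implication (i) $\Rightarrow$ (ii), the functions appearing in the spectral coercivity of $C$ in (i)), and $\theta_0,\theta_1,\theta_2$ are positive universal constants that do not depend on $z_0$. In addition, $\mathtt T\in\Sigma_i$ (with $\mathtt T$ extended to $\mathbb R$ as an even function).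
   Context: Setting. $H$ and $Y$ are complex Hilbert spaces. $A_0:D(A_0)\subset H\to H$ is an unbounded self-adjoint positive operator with compact resolvent. For $\beta\ge 0$, $H_\beta=D(A_0^{\beta/2})$ with norm $\|u\|_{H_\beta}=\|A_0^{\beta/2}u\|_H$ (so $H_2=D(A_0)$, $H_1=D(A_0^{1/2})$). $(\lambda_k)_{k\in\mathbb{N}^*}$ is the non-decreasing sequence of (positive) eigenvalues of $A_0^{1/2}$, and $(\phi_k)_{k\in\mathbb{N}^*}$ is a corresponding orthonormal basis of eigenvectors in $H$. $C_0\in\mathcal L(D(A_0),Y)$ is a bounded linear operator. Let $X=H_1\times H$ with the product norm $\|(u,v)\|_X^2=\|A_0^{1/2}u\|_H^2+\|v\|_H^2$, and $$A=-i\begin{pmatrix}0&I\\-A_0&0\end{pmatrix},\quad D(A)=D(A_0)\times H_1,\qquad C=\begin{pmatrix}C_0&0\end{pmatrix}\in\mathcal L(D(A),Y),$$ so $A(u,v)=(-iv,\,iA_0u)$ is self-adjoint on $X$ with compact resolvent, and $C(u,v)=C_0u$. By Stone's theorem $iA$ generates a strongly continuous group of isometries $(e^{itA})_{t\in\mathbb{R}}$ on $X$. Standing assumption: $C$ is admissible, i.e. for every $T>0$ there is $C_T>0$ with $\int_0^T\|Ce^{itA}z_0\|_Y^2dt\le C_T\|z_0\|_X^2$ for all $z_0\in D(A)$ ($C_T$ taken non-decreasing in $T$). Eigenpairs of $A$: for $k\in\mathbb{Z}^*=\mathbb{Z}\setminus\{0\}$, $\mu_k=\operatorname{sign}(k)\lambda_{|k|}$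 and $\psi_k=\frac1{\sqrt2}\big(\frac1{i\mu_k}\phi_{|k|},\phi_{|k|}\big)^t$; $(\psi_k)$ is an orthonormal basis of $X$ with $A\psi_k=\mu_k\psi_k$. Frequency functions: for $z\in D(A)\setminus\{0\}$, $$\lambda_A(z)=\frac{\langle Az,z\rangle_X}{\|z\|_X^2}=\frac{\sum_{k\in\mathbb{Z}^*}\mu_k|\langle z,\psi_k\rangle_X|^2}{\sum_{k\in\mathbb{Z}^*}|\langle z,\psi_k\rangle_X|^2},\qquad \lambda_{|A|}(z)=\frac{\sum_{k\in\mathbb{Z}^*}\lambda_{|k|}|\langle z,\psi_k\rangle_X|^2}{\sum_{k\in\mathbb{Z}^*}|\langle z,\psi_k\rangle_X|^2}.$$ $\Sigma_d$ (resp. $\Sigma_i$) is the set of functions $\mathbb{R}\to(0,\infty)$ that are even, continuous, and non-increasing (resp. non-decreasing) on $[0,\infty)$. Spectral coercivity of $C$ means assertion (i) of the claim. Weak observability: the system is weakly observable if there exist $\mathtt T\in\Sigma_i$ and $\Psi\in\Sigma_d$ such that $\Psi(\lambda_{|A|}(z_0))\|z_0\|_X^2\le\int_0^{\mathtt T(\lambda_{|A|}(z_0))}\|Ce^{itA}z_0\|_Y^2dt$ for all $z_0\in D(A)\setminus\{0\}$.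
   Formalization: The constants θ0, θ1, θ2 do not depend on z0, ε or Ψ, but may depend on the system (A0, C0); constants universal over all systems are impossible, e.g. C0 = A0^{1/2}, ε = λ_1²/16, Ψ = 1/4 with λ_1 large. *)

theory Defs
  imports "HOL-Analysis.Analysis"
begin

text \<open>
  Complex Hilbert spaces. The inner product is linear in the first argument; its real part is the
  inner product of the underlying real Hilbert space, so that the norm, topology and completeness
  are those of \<^class>\<open>real_inner\<close> and \<^class>\<open>complete_space\<close>.
\<close>

class complex_hilbert = real_inner + complete_space +
  fixes scaleC :: "complex \<Rightarrow> 'a \<Rightarrow> 'a" (infixr "*\<^sub>C" 75)
    and cinner :: "'a \<Rightarrow> 'a \<Rightarrow> complex"
  assumes scaleC_add_right: "c *\<^sub>C (x + y) = c *\<^sub>C x + c *\<^sub>C y"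
    and scaleC_add_left: "(c + d) *\<^sub>C x = c *\<^sub>C x + d *\<^sub>C x"
    and scaleC_scaleC: "c *\<^sub>C d *\<^sub>C x = (c * d) *\<^sub>C x"
    and scaleC_of_real: "complex_of_real r *\<^sub>C x = r *\<^sub>R x"
    and cinner_commute: "cinner x y = cnj (cinner y x)"
    and cinner_add_left: "cinner (x + y) z = cinner x z + cinner y z"
    and cinner_scaleC_left: "cinner (c *\<^sub>C x) y = c * cinner x y"
    and inner_eq_Re_cinner: "inner x y = Re (cinner x y)"

instantiation complex :: complex_hilbert
begin

definition "scaleC_complex (c::complex) x = c * x"
definition "cinner_complex (x::complex) y = x * cnj y"

instance
  by standard
    (auto simp: scaleC_complex_def cinner_complex_def inner_complex_def algebra_simps scaleR_conv_of_real)

end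

instantiation prod :: (complex_hilbert, complex_hilbert) complex_hilbert
begin

definition "c *\<^sub>C z = (c *\<^sub>C fst z, c *\<^sub>C snd z)"
definition "cinner z w = cinner (fst z) (fst w) + cinner (snd z) (snd w)"

instance
proof
  fix z w :: "'a \<times> 'b"
  show "cinner z w = cnj (cinner w z)"
    unfolding cinner_prod_def complex_cnj_add
    by (simp only: cinner_commute[symmetric])
qed (auto simp: scaleC_prod_def cinner_prod_def inner_prod_def scaleC_add_right scaleC_add_left
      scaleC_scaleC scaleC_of_real cinner_add_left cinner_scaleC_left inner_eq_Re_cinner
      scaleR_prod_def algebra_simps)

end

text \<open>
  An unbounded operator is given by its domain \<open>D\<close> and a function \<open>A\<close>, whose values outside \<open>D\<close>
  are irrelevant.
\<close>

definition csubspace :: "'a::complex_hilbert set \<Rightarrow> bool" where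
  "csubspace D \<longleftrightarrow> 0 \<in> D \<and> (\<forall>x\<in>D. \<forall>y\<in>D. x + y \<in> D) \<and> (\<forall>c. \<forall>x\<in>D. c *\<^sub>C x \<in> D)"

definition clinear_on :: "'a::complex_hilbert set \<Rightarrow> ('a \<Rightarrow> 'b::complex_hilbert) \<Rightarrow> bool" where
  "clinear_on D A \<longleftrightarrow> csubspace D \<and> (\<forall>x\<in>D. \<forall>y\<in>D. A (x + y) = A x + A y)
    \<and> (\<forall>c. \<forall>x\<in>D. A (c *\<^sub>C x) = c *\<^sub>C A x)"

definition adjoint_graph ::
  "'a::complex_hilbert set \<Rightarrow> ('a \<Rightarrow> 'a) \<Rightarrow> ('a \<times> 'a) set" where
  "adjoint_graph D A = {(v, w). \<forall>u\<in>D. cinner (A u) v = cinner u w}"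

definition self_adjoint :: "'a::complex_hilbert set \<Rightarrow> ('a \<Rightarrow> 'a) \<Rightarrow> bool" where
  "self_adjoint D A \<longleftrightarrow> clinear_on D A \<and> closure D = UNIV
    \<and> adjoint_graph D A = {(v, A v) | v. v \<in> D}"

definition positive_on :: "'a::complex_hilbert set \<Rightarrow> ('a \<Rightarrow> 'a) \<Rightarrow> bool" where
  "positive_on D A \<longleftrightarrow> (\<forall>u\<in>D. u \<noteq> 0 \<longrightarrow> 0 < Re (cinner (A u) u))"

definition compact_resolvent :: "'a::complex_hilbert set \<Rightarrow> ('a \<Rightarrow> 'a) \<Rightarrow> bool" where
  "compact_resolvent D A \<longleftrightarrow> (\<exists>(\<zeta>::complex) R.
      (\<forall>f. R f \<in> D \<and> A (R f) - \<zeta> *\<^sub>C R f = f)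
    \<and> (\<forall>u\<in>D. R (A u - \<zeta> *\<^sub>C u) = u)
    \<and> (\<forall>B. bounded B \<longrightarrow> compact (closure (R ` B))))"

text \<open>
  \<open>(D1, S)\<close> is the positive square root of \<open>(D0, A0)\<close>, including equality of the domains of
  \<open>S \<circ> S\<close> and \<open>A0\<close>. Thus \<open>D1\<close> is the space \<open>H\<^sub>1\<close>, and \<open>D0\<close> is \<open>H\<^sub>2\<close>.
\<close>

definition operator_sqrt ::
  "'a::complex_hilbert set \<Rightarrow> ('a \<Rightarrow> 'a) \<Rightarrow> 'a set \<Rightarrow> ('a \<Rightarrow> 'a) \<Rightarrow> bool" where
  "operator_sqrt D0 A0 D1 S \<longleftrightarrow> self_adjoint D1 S \<and> positive_on D1 S
    \<and> D0 = {u \<in> D1. S u \<in> D1} \<and> (\<forall>u\<in>D0. A0 u = S (S u))"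

text \<open>Indices start at 1; the values at 0 are irrelevant.\<close>

definition eigenbasis ::
  "'a::complex_hilbert set \<Rightarrow> ('a \<Rightarrow> 'a) \<Rightarrow> (nat \<Rightarrow> real) \<Rightarrow> (nat \<Rightarrow> 'a) \<Rightarrow> bool" where
  "eigenbasis D1 S lam \<phi> \<longleftrightarrow>
      (\<forall>k\<ge>1. 0 < lam k \<and> \<phi> k \<in> D1 \<and> S (\<phi> k) = lam k *\<^sub>R \<phi> k)
    \<and> (\<forall>j\<ge>1. \<forall>k\<ge>j. lam j \<le> lam k)
    \<and> (\<forall>j\<ge>1. \<forall>k\<ge>1. cinner (\<phi> j) (\<phi> k) = (if j = k then 1 else 0))
    \<and> (\<forall>u. ((\<lambda>k. cinner u (\<phi> k) *\<^sub>C \<phi> k) has_sum u) {1..})"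

definition obs_bounded ::
  "'a::complex_hilbert set \<Rightarrow> ('a \<Rightarrow> 'a) \<Rightarrow> ('a \<Rightarrow> 'b::complex_hilbert) \<Rightarrow> bool" where
  "obs_bounded D0 A0 C0 \<longleftrightarrow> clinear_on D0 C0 \<and> (\<exists>M. \<forall>u\<in>D0. norm (C0 u) \<le> M * norm (A0 u))"

text \<open>
  The energy space \<open>X = H\<^sub>1 \<times> H\<close> is the subset \<open>D1 \<times> UNIV\<close> of the product type, with its own
  inner product and norm; these differ from the ones the product type carries.
\<close>

definition X_space :: "'a::complex_hilbert set \<Rightarrow> ('a \<times> 'a) set" where
  "X_space D1 = D1 \<times> UNIV"

definition X_inner :: "('a::complex_hilbert \<Rightarrow> 'a) \<Rightarrow> 'a \<times> 'a \<Rightarrow> 'a \<times> 'a \<Rightarrow> complex" where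
  "X_inner S z w = cinner (S (fst z)) (S (fst w)) + cinner (snd z) (snd w)"

definition X_norm :: "('a::complex_hilbert \<Rightarrow> 'a) \<Rightarrow> 'a \<times> 'a \<Rightarrow> real" where
  "X_norm S z = sqrt ((norm (S (fst z)))\<^sup>2 + (norm (snd z))\<^sup>2)"

definition A_dom :: "'a::complex_hilbert set \<Rightarrow> 'a set \<Rightarrow> ('a \<times> 'a) set" where
  "A_dom D0 D1 = D0 \<times> D1"

definition A_op :: "('a::complex_hilbert \<Rightarrow> 'a) \<Rightarrow> 'a \<times> 'a \<Rightarrow> 'a \<times> 'a" where
  "A_op A0 z = (- \<i>) *\<^sub>C (snd z, - A0 (fst z))"

definition C_op :: "('a::complex_hilbert \<Rightarrow> 'b::complex_hilbert) \<Rightarrow> 'a \<times> 'a \<Rightarrow> 'b" where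
  "C_op C0 z = C0 (fst z)"

text \<open>
  \<open>U\<close> is the strongly continuous group of isometries of \<open>X\<close> whose generator is \<open>\<i>A\<close>, with domain
  exactly \<open>D(A)\<close>; this determines \<open>U t = e\<^sup>i\<^sup>t\<^sup>A\<close> on \<open>X\<close>.
\<close>

definition isometry_group_generated_by ::
  "'a::complex_hilbert set \<Rightarrow> ('a \<Rightarrow> 'a) \<Rightarrow> 'a set \<Rightarrow> ('a \<Rightarrow> 'a)
    \<Rightarrow> (real \<Rightarrow> 'a \<times> 'a \<Rightarrow> 'a \<times> 'a) \<Rightarrow> bool" where
  "isometry_group_generated_by D0 A0 D1 S U \<longleftrightarrow>
      (\<forall>t. clinear_on (X_space D1) (U t))
    \<and> (\<forall>t. \<forall>z\<in>X_space D1. U t z \<in> X_space D1 \<and> X_norm S (U t z) = X_norm S z)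
    \<and> (\<forall>z\<in>X_space D1. U 0 z = z)
    \<and> (\<forall>s t. \<forall>z\<in>X_space D1. U (s + t) z = U s (U t z))
    \<and> (\<forall>z\<in>X_space D1. ((\<lambda>t. X_norm S (U t z - z)) \<longlongrightarrow> 0) (at 0))
    \<and> (\<forall>z\<in>X_space D1. \<forall>w\<in>X_space D1.
          ((\<lambda>t. X_norm S ((1 / t) *\<^sub>R (U t z - z) - w)) \<longlongrightarrow> 0) (at 0)
            \<longleftrightarrow> z \<in> A_dom D0 D1 \<and> w = \<i> *\<^sub>C A_op A0 z)"

definition observed_energy ::
  "('a::complex_hilbert \<Rightarrow> 'b::complex_hilbert) \<Rightarrow> (real \<Rightarrow> 'a \<times> 'a \<Rightarrow> 'a \<times> 'a)
    \<Rightarrow> real \<Rightarrow> 'a \<times> 'a \<Rightarrow> real" where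
  "observed_energy C0 U T z0 = integral {0..T} (\<lambda>t. (norm (C_op C0 (U t z0)))\<^sup>2)"

definition admissible ::
  "'a::complex_hilbert set \<Rightarrow> 'a set \<Rightarrow> ('a \<Rightarrow> 'a) \<Rightarrow> ('a \<Rightarrow> 'b::complex_hilbert)
    \<Rightarrow> (real \<Rightarrow> 'a \<times> 'a \<Rightarrow> 'a \<times> 'a) \<Rightarrow> bool" where
  "admissible D0 D1 S C0 U \<longleftrightarrow> (\<forall>T>0. \<exists>K>0. \<forall>z0\<in>A_dom D0 D1.
      observed_energy C0 U T z0 \<le> K * (X_norm S z0)\<^sup>2)"

definition eig_A :: "(nat \<Rightarrow> real) \<Rightarrow> int \<Rightarrow> real" where
  "eig_A lam k = of_int (sgn k) * lam (nat \<bar>k\<bar>)"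

definition eigvec_A ::
  "(nat \<Rightarrow> real) \<Rightarrow> (nat \<Rightarrow> 'a::complex_hilbert) \<Rightarrow> int \<Rightarrow> 'a \<times> 'a" where
  "eigvec_A lam \<phi> k = complex_of_real (1 / sqrt 2) *\<^sub>C
      ((1 / (\<i> * complex_of_real (eig_A lam k))) *\<^sub>C \<phi> (nat \<bar>k\<bar>), \<phi> (nat \<bar>k\<bar>))"

text \<open>\<open>\<langle>Az, z\<rangle>\<^sub>X\<close> is real because \<open>A\<close> is self-adjoint on \<open>X\<close>, so \<open>Re\<close> loses nothing.\<close>

definition freq_A ::
  "('a::complex_hilbert \<Rightarrow> 'a) \<Rightarrow> ('a \<Rightarrow> 'a) \<Rightarrow> 'a \<times> 'a \<Rightarrow> real" where
  "freq_A A0 S z = Re (X_inner S (A_op A0 z) z) / (X_norm S z)\<^sup>2"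

definition freq_absA ::
  "('a::complex_hilbert \<Rightarrow> 'a) \<Rightarrow> (nat \<Rightarrow> real) \<Rightarrow> (nat \<Rightarrow> 'a) \<Rightarrow> 'a \<times> 'a \<Rightarrow> real" where
  "freq_absA S lam \<phi> z =
      (\<Sum>\<^sub>\<infinity>k\<in>-{0::int}. lam (nat \<bar>k\<bar>) * (cmod (X_inner S z (eigvec_A lam \<phi> k)))\<^sup>2)
    / (\<Sum>\<^sub>\<infinity>k\<in>-{0::int}. (cmod (X_inner S z (eigvec_A lam \<phi> k)))\<^sup>2)"

definition Sigma_d :: "(real \<Rightarrow> real) set" where
  "Sigma_d = {f. (\<forall>x. 0 < f x) \<and> (\<forall>x. f (- x) = f x) \<and> continuous_on UNIV f
    \<and> antimono_on {0..} f}"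

definition Sigma_i :: "(real \<Rightarrow> real) set" where
  "Sigma_i = {f. (\<forall>x. 0 < f x) \<and> (\<forall>x. f (- x) = f x) \<and> continuous_on UNIV f
    \<and> mono_on {0..} f}"

definition spectrally_coercive_with where
  "spectrally_coercive_with D0 A0 D1 S lam \<phi> C0 \<epsilon> \<Psi> \<longleftrightarrow>
    (\<forall>z \<in> A_dom D0 D1 - {0}.
      (X_norm S (A_op A0 z))\<^sup>2 / (X_norm S z)\<^sup>2 - (freq_A A0 S z)\<^sup>2 \<le> \<epsilon> (freq_absA S lam \<phi> z) \<longrightarrow>
      (norm (C_op C0 z))\<^sup>2 \<ge> \<Psi> (freq_absA S lam \<phi> z) * (X_norm S z)\<^sup>2)"

definition spectrally_coercive where
  "spectrally_coercive D0 A0 D1 S lam \<phi> C0 \<longleftrightarrow>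
    (\<exists>\<epsilon>\<in>Sigma_d. \<exists>\<Psi>\<in>Sigma_d. spectrally_coercive_with D0 A0 D1 S lam \<phi> C0 \<epsilon> \<Psi>)"

definition weakly_observable where
  "weakly_observable D0 D1 S lam \<phi> C0 U \<longleftrightarrow>
    (\<exists>\<T>\<in>Sigma_i. \<exists>\<Psi>\<in>Sigma_d. \<forall>z0 \<in> A_dom D0 D1 - {0}.
      \<Psi> (freq_absA S lam \<phi> z0) * (X_norm S z0)\<^sup>2
        \<le> observed_energy C0 U (\<T> (freq_absA S lam \<phi> z0)) z0)"

definition obs_time_eq :: "(real \<Rightarrow> real) \<Rightarrow> real \<Rightarrow> real \<Rightarrow> real \<Rightarrow> real \<Rightarrow> bool" where
  "obs_time_eq \<epsilon> \<theta>0 \<theta>1 l T \<longleftrightarrow> T > 0 \<and> T * \<epsilon> (\<theta>0 * (1 / T + l)) = \<theta>1"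

text \<open>The argument \<open>\<bar>l\<bar>\<close> is the extension from \<open>l \<ge> 0\<close> to an even function.\<close>

definition obs_time :: "(real \<Rightarrow> real) \<Rightarrow> real \<Rightarrow> real \<Rightarrow> real \<Rightarrow> real" where
  "obs_time \<epsilon> \<theta>0 \<theta>1 l = (THE T. obs_time_eq \<epsilon> \<theta>0 \<theta>1 \<bar>l\<bar> T)"

definition weak_obs_ineq where
  "weak_obs_ineq D0 D1 S lam \<phi> C0 U \<epsilon> \<Psi> \<theta>0 \<theta>1 \<theta>2 \<longleftrightarrow>
    (\<forall>z0 \<in> A_dom D0 D1 - {0}. \<forall>T \<ge> obs_time \<epsilon> \<theta>0 \<theta>1 (freq_absA S lam \<phi> z0).
      \<theta>2 * \<Psi> (\<theta>0 * (1 / T + freq_absA S lam \<phi> z0)) * (X_norm S z0)\<^sup>2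
        \<le> observed_energy C0 U T z0)"

end

theory Submission
  imports Defs
begin

text \<open>
  The map \<open>(u, v) \<mapsto> (S u, v)\<close> carries the energy space isometrically onto \<open>H \<times> H\<close>. There \<open>A\<close> is
  diagonal in an orthonormal basis with real eigenvalues \<open>\<mu>\<^sub>k\<close>, and the group multiplies the \<open>k\<close>-th
  coefficient by \<open>cis (\<mu>\<^sub>k t)\<close>. All estimates are first proved for finite combinations of
  eigenvectors, where every object is an explicit finite sum, and then extended to \<open>D(A)\<close> by density
  in the graph norm: \<open>C\<close> is bounded for this norm and the group preserves it, so that the outputs
  converge uniformly in time (\<open>C_trunc_uniform\<close>).

  Coercivity implies observability (\<open>observability_comb\<close>). Multiply the orbit of \<open>z = \<Sum> a\<^sub>k \<psi>\<^sub>k\<close> by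
  the window \<open>sin (\<pi> t / T)\<close> and take Fourier coefficients on \<open>[0, T]\<close> at the grid frequencies
  \<open>\<tau>\<^sub>n = 2 \<pi> n / T\<close>. They are wave packets \<open>w\<^sub>n = \<Sum> \<chi>(\<mu>\<^sub>k - \<tau>\<^sub>n) a\<^sub>k \<psi>\<^sub>k\<close>, where \<open>\<chi>\<close> is the transform of the
  window. Bessel's inequality bounds the total frequency content of the packets by that of \<open>z\<close>, the
  sum of \<open>\<parallel>(A - \<tau>\<^sub>n) w\<^sub>n\<parallel>\<^sup>2\<close> by \<open>\<pi>\<^sup>2 \<parallel>z\<parallel>\<^sup>2 / (2 T\<^sup>2)\<close>, which is the energy of the derivative of the window,
  and the sum of \<open>\<parallel>C w\<^sub>n\<parallel>\<^sup>2\<close> by the mean observed energy. Conversely the packets carry at least a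
  quarter of \<open>\<parallel>z\<parallel>\<^sup>2\<close>, because every \<open>\<mu>\<^sub>k\<close> lies within \<open>\<pi> / T\<close> of some \<open>\<tau>\<^sub>n\<close>, and \<open>\<chi>\<close> is at least
  \<open>1 / 2\<close> in modulus on that range. By Chebyshev's inequality the packets with frequency at most
  \<open>8 \<lambda>(z)\<close> and small defect carry an eighth of \<open>\<parallel>z\<parallel>\<^sup>2\<close>, and spectral coercivity applies to each of them.

  This argument needs \<open>8 \<pi>\<^sup>2 / T\<^sup>2 < \<epsilon> (8 \<lambda>)\<close>, which is quadratic in \<open>1 / T\<close>, whereas the equation for
  the observation time is linear in it. The gap closes because \<open>C\<close> sees only the first component:
  the state \<open>(0, \<phi>\<^sub>1)\<close> is invisible, has frequency \<open>\<lambda>\<^sub>1\<close> and variance \<open>\<lambda>\<^sub>1\<^sup>2\<close>, so coercivity forces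
  \<open>\<epsilon> (\<lambda>\<^sub>1) < \<lambda>\<^sub>1\<^sup>2\<close> (\<open>coercivity_width_bound\<close>). Hence the observation time exceeds \<open>\<theta>\<^sub>1 / \<lambda>\<^sub>1\<^sup>2\<close>, and a
  \<open>\<theta>\<^sub>1\<close> proportional to \<open>\<lambda>\<^sub>1\<close> turns the linear condition into the quadratic one.

  Observability implies coercivity (\<open>spectrally_coercive_if_weakly_observable\<close>). If \<open>A z\<close> is close
  to \<open>\<tau> z\<close>, the orbit of \<open>z\<close> stays close to \<open>cis (\<tau> t) z\<close>; Duhamel's formula and admissibility bound
  the observed energy by \<open>2 T \<parallel>C z\<parallel>\<^sup>2\<close> plus a multiple of \<open>\<parallel>(A - \<tau>) z\<parallel>\<^sup>2\<close>. With \<open>\<tau> = \<lambda>\<^sub>A(z)\<close> the last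
  norm is governed by the variance, and a small \<open>\<epsilon>\<close> lets the left-hand side absorb it.
\<close>

section \<open>Calculus in complex Hilbert spaces\<close>

subclass (in complex_hilbert) banach ..

lemma scaleC_one [simp]: "1 *\<^sub>C x = x"
  using scaleC_of_real[of 1 x] by simp

lemma scaleC_zero_left [simp]: "0 *\<^sub>C x = 0"
  using scaleC_of_real[of 0 x] by simp

lemma scaleC_zero_right [simp]: "c *\<^sub>C (0::'a::complex_hilbert) = 0"
  using scaleC_add_right[of c 0 "0::'a"] by simp

lemma scaleC_minus_left: "(- c) *\<^sub>C x = - (c *\<^sub>C x)"
  using scaleC_add_left[of c "- c" x] by (simp add: add_eq_0_iff)

lemma scaleC_minus_right: "c *\<^sub>C (- x) = - (c *\<^sub>C x)"
  using scaleC_add_right[of c x "- x"] by (simp add: add_eq_0_iff)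

lemma scaleC_diff_left: "(c - d) *\<^sub>C x = c *\<^sub>C x - d *\<^sub>C x"
  using scaleC_add_left[of c "- d" x] by (simp add: scaleC_minus_left)

lemma scaleC_diff_right: "c *\<^sub>C (x - y) = c *\<^sub>C x - c *\<^sub>C y"
  using scaleC_add_right[of c x "- y"] by (simp add: scaleC_minus_right)

lemma scaleC_sum_right: "c *\<^sub>C (\<Sum>i\<in>F. x i) = (\<Sum>i\<in>F. c *\<^sub>C x i)"
  by (induction F rule: infinite_finite_induct) (simp_all add: scaleC_add_right)

lemma cinner_zero_left [simp]: "cinner 0 y = 0"
  using cinner_scaleC_left[of 0 0 y] by simp

lemma cinner_minus_left: "cinner (- x) y = - cinner x y"
  using cinner_add_left[of x "- x" y] by (simp add: add_eq_0_iff)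

lemma cinner_diff_left: "cinner (x - z) y = cinner x y - cinner z y"
  using cinner_add_left[of x "- z" y] by (simp add: cinner_minus_left)

lemma cinner_zero_right [simp]: "cinner y 0 = 0"
  by (subst cinner_commute) simp

lemma cinner_add_right: "cinner z (x + y) = cinner z x + cinner z y"
  by (metis cinner_add_left cinner_commute complex_cnj_add)

lemma cinner_scaleC_right: "cinner x (c *\<^sub>C y) = cnj c * cinner x y"
  by (metis cinner_commute cinner_scaleC_left complex_cnj_mult)

lemma cinner_sum_left: "cinner (\<Sum>i\<in>F. x i) y = (\<Sum>i\<in>F. cinner (x i) y)"
  by (induction F rule: infinite_finite_induct) (simp_all add: cinner_add_left)

lemma cinner_sum_right: "cinner y (\<Sum>i\<in>F. x i) = (\<Sum>i\<in>F. cinner y (x i))"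
  by (induction F rule: infinite_finite_induct) (simp_all add: cinner_add_right)

lemma cinner_self: "cinner x x = complex_of_real ((norm x)\<^sup>2)"
proof -
  have "Im (cinner x x) = 0"
    using arg_cong[OF cinner_commute[of x x], of Im] by simp
  then show ?thesis
    by (simp add: complex_eq_iff power2_norm_eq_inner inner_eq_Re_cinner)
qed

lemma norm_scaleC: "norm (c *\<^sub>C x) = cmod c * norm x"
proof -
  have "complex_of_real ((norm (c *\<^sub>C x))\<^sup>2) = c * cnj c * cinner x x"
    unfolding cinner_self[symmetric] by (simp add: cinner_scaleC_left cinner_scaleC_right)
  also have "\<dots> = complex_of_real ((cmod c * norm x)\<^sup>2)"
    by (simp add: cinner_self complex_norm_square[symmetric] power_mult_distrib)
  finally have "(norm (c *\<^sub>C x))\<^sup>2 = (cmod c * norm x)\<^sup>2"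
    using of_real_eq_iff by blast
  then show ?thesis by simp
qed

lemma cinner_Cauchy_Schwarz: "cmod (cinner x y) \<le> norm x * norm y"
proof (cases "cinner x y = 0")
  case False
  define c where "c = cnj (sgn (cinner x y))"
  have "complex_of_real (cmod (cinner x y)) = c * cinner x y"
    using False unfolding c_def sgn_div_norm
    by (simp add: scaleR_conv_of_real field_simps complex_norm_square[symmetric] power2_eq_square)
  then have "cmod (cinner x y) = Re (cinner (c *\<^sub>C x) y)"
    by (metis Re_complex_of_real cinner_scaleC_left)
  also have "\<dots> = inner (c *\<^sub>C x) y" by (simp add: inner_eq_Re_cinner)
  also have "\<dots> \<le> norm (c *\<^sub>C x) * norm y" by (rule norm_cauchy_schwarz)
  also have "norm (c *\<^sub>C x) = norm x" using False by (simp add: norm_scaleC c_def norm_sgn)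
  finally show ?thesis .
qed simp

lemma scaleR_scaleC: "r *\<^sub>R x = complex_of_real r *\<^sub>C x"
  by (simp add: scaleC_of_real)

lemma scaleC_scaleR_commute: "c *\<^sub>C (r *\<^sub>R x) = r *\<^sub>R (c *\<^sub>C x)"
  by (simp add: scaleR_scaleC scaleC_scaleC mult.commute)

lemma bounded_linear_scaleC: "bounded_linear (\<lambda>x. c *\<^sub>C x)"
  by (rule bounded_linear_intro[where K = "cmod c"])
    (simp_all add: scaleC_add_right scaleC_scaleR_commute norm_scaleC mult.commute)

lemma bounded_linear_scaleC_left: "bounded_linear (\<lambda>c. c *\<^sub>C x)"
  by (rule bounded_linear_intro[where K = "norm x"])
    (simp_all add: scaleC_add_left scaleR_conv_of_real scaleC_scaleC[symmetric] scaleC_of_real norm_scaleC)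

lemmas continuous_on_scaleC_left [continuous_intros] =
  bounded_linear.continuous_on[OF bounded_linear_scaleC_left]
lemma norm_diff_sq: "(norm (x - y))\<^sup>2 = (norm x)\<^sup>2 - 2 * Re (cinner x y) + (norm y)\<^sup>2"
  by (simp add: power2_norm_eq_inner inner_diff_left inner_diff_right inner_commute inner_eq_Re_cinner[symmetric])

lemma norm_sum_orthonormal:
  assumes "finite F" "\<And>j k. j \<in> F \<Longrightarrow> k \<in> F \<Longrightarrow> cinner (e j) (e k) = (if j = k then 1 else 0)"
  shows "(norm (\<Sum>k\<in>F. a k *\<^sub>C e k))\<^sup>2 = (\<Sum>k\<in>F. (cmod (a k))\<^sup>2)"
proof -
  have "complex_of_real ((norm (\<Sum>k\<in>F. a k *\<^sub>C e k))\<^sup>2) =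
      (\<Sum>j\<in>F. \<Sum>k\<in>F. a j * cnj (a k) * cinner (e j) (e k))"
    unfolding cinner_self[symmetric]
    by (simp add: cinner_sum_left cinner_sum_right cinner_scaleC_left cinner_scaleC_right
        mult_ac sum_distrib_left) (rule sum.swap)
  also have "\<dots> = (\<Sum>j\<in>F. \<Sum>k\<in>F. if k = j then a j * cnj (a j) else 0)"
    by (intro sum.cong refl) (auto simp: assms)
  also have "\<dots> = complex_of_real (\<Sum>k\<in>F. (cmod (a k))\<^sup>2)"
    using assms by (simp add: sum.delta complex_norm_square[symmetric])
  finally show ?thesis using of_real_eq_iff by blast
qed

lemma cinner_ext: "(\<And>w. cinner x w = cinner y w) \<Longrightarrow> x = y"
  using cinner_self[of "x - y"] by (simp add: cinner_diff_left)

lemma cinner_scaleR_left: "cinner (r *\<^sub>R x) y = of_real r * cinner x y"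
  by (simp only: scaleR_scaleC cinner_scaleC_left)

lemma csubspace_sum:
  assumes "csubspace D" "\<And>i. i \<in> F \<Longrightarrow> x i \<in> D"
  shows "(\<Sum>i\<in>F. c i *\<^sub>C x i) \<in> D"
  using assms(2)
  by (induction F rule: infinite_finite_induct) (use assms(1) in \<open>auto simp: csubspace_def\<close>)

lemma clinear_on_zero: "clinear_on D f \<Longrightarrow> f 0 = 0"
  unfolding clinear_on_def csubspace_def by (metis (no_types) scaleC_zero_left)

lemma clinear_on_sum:
  assumes f: "clinear_on D f" and "\<And>i. i \<in> F \<Longrightarrow> x i \<in> D"
  shows "f (\<Sum>i\<in>F. c i *\<^sub>C x i) = (\<Sum>i\<in>F. c i *\<^sub>C f (x i))"
  using assms(2)
proof (induction F rule: infinite_finite_induct)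
  case (insert i F)
  have "(\<Sum>i\<in>F. c i *\<^sub>C x i) \<in> D" "c i *\<^sub>C x i \<in> D"
    using f insert.prems by (auto simp: clinear_on_def csubspace_def intro!: csubspace_sum)
  then show ?case using insert f by (simp add: clinear_on_def)
qed (use f in \<open>auto simp: clinear_on_zero\<close>)

text \<open>
  Closure of subspaces and additivity of operators are given for sums and complex multiples only;
  this reduces differences to these.
\<close>

lemma diff_eq_add_scaleC: "x - y = x + (- 1) *\<^sub>C (y::'a::complex_hilbert)"
  by (simp add: scaleC_minus_left)

lemma csubspace_diff: "csubspace D \<Longrightarrow> x \<in> D \<Longrightarrow> y \<in> D \<Longrightarrow> x - y \<in> D"
  unfolding csubspace_def diff_eq_add_scaleC by blast

lemma clinear_on_diff:
  assumes "clinear_on D f" "x \<in> D" "y \<in> D" shows "f (x - y) = f x - f y"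
proof -
  have "(- 1) *\<^sub>C y \<in> D" using assms by (simp add: clinear_on_def csubspace_def)
  then show ?thesis using assms unfolding diff_eq_add_scaleC clinear_on_def by simp
qed

lemma clinear_on_scaleR: "clinear_on D f \<Longrightarrow> x \<in> D \<Longrightarrow> f (r *\<^sub>R x) = r *\<^sub>R f x"
  unfolding clinear_on_def scaleR_scaleC by blast

section \<open>A Bessel inequality for Hilbert-space valued functions\<close>

text \<open>
  The variance of \<open>f\<close> on \<open>[0, T]\<close> is nonnegative.
\<close>

lemma integral_sq_le:
  fixes f :: "real \<Rightarrow> real"
  assumes T: "T \<ge> 0" and f: "continuous_on {0..T} f"
  shows "(integral {0..T} f)\<^sup>2 \<le> T * integral {0..T} (\<lambda>t. (f t)\<^sup>2)"
proof (cases "T = 0")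
  case False
  with T have T: "T > 0" by simp
  define I where "I = integral {0..T} f"
  define m where "m = I / T"
  have "(f has_integral I) {0..T}" unfolding I_def
    by (intro integrable_integral integrable_continuous_real f)
  moreover have "((\<lambda>t. (f t)\<^sup>2) has_integral integral {0..T} (\<lambda>t. (f t)\<^sup>2)) {0..T}"
    by (intro integrable_integral integrable_continuous_real continuous_intros f)
  moreover have "((\<lambda>t. m\<^sup>2) has_integral T * m\<^sup>2) {0..T}"
    using has_integral_const_real[of "m\<^sup>2" 0 T] T by simp
  ultimately have "((\<lambda>t. (f t)\<^sup>2 - 2 * m * f t + m\<^sup>2) has_integral
      integral {0..T} (\<lambda>t. (f t)\<^sup>2) - 2 * m * I + T * m\<^sup>2) {0..T}"
    by (intro has_integral_add has_integral_diff has_integral_mult_right)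
  then have "0 \<le> integral {0..T} (\<lambda>t. (f t)\<^sup>2) - 2 * m * I + T * m\<^sup>2"
  proof (rule has_integral_nonneg)
    fix t
    have "(f t)\<^sup>2 - 2 * m * f t + m\<^sup>2 = (f t - m)\<^sup>2" by (simp add: power2_diff)
    then show "0 \<le> (f t)\<^sup>2 - 2 * m * f t + m\<^sup>2" by simp
  qed
  also have "\<dots> = integral {0..T} (\<lambda>t. (f t)\<^sup>2) - I\<^sup>2 / T"
    using T by (simp add: m_def power2_eq_square)
  finally show ?thesis using T by (simp add: I_def field_simps)
qed simp

lemma cis_has_vector_derivative:
  "((\<lambda>t. cis (a * t)) has_vector_derivative \<i> * of_real a * cis (a * t)) (at t within X)"
proof -
  have "((\<lambda>t. Complex (cos (a * t)) (sin (a * t))) has_vector_derivative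
      Complex (- (a * sin (a * t))) (a * cos (a * t))) (at t within X)"
    unfolding Complex_eq
    by (auto intro!: derivative_eq_intros simp: scaleR_conv_of_real has_vector_derivative_def has_derivative_of_real
       algebra_simps)
  moreover have "Complex (- (a * sin (a * t))) (a * cos (a * t)) = \<i> * of_real a * cis (a * t)"
    by (simp add: complex_eq_iff)
  ultimately show ?thesis by (simp add: cis.ctr)
qed

lemma integral_cis_period:
  assumes "T > 0"
  shows "((\<lambda>t. cis (2 * pi * of_int m / T * t)) has_integral (if m = 0 then of_real T else 0)) {0..T}"
proof (cases "m = 0")
  case True
  then show ?thesis
    using has_integral_const_real[of "1::complex" 0 T] assms by (simp add: scaleR_conv_of_real)
next
  case False
  define a where "a = 2 * pi * of_int m / T"
  have a: "a \<noteq> 0" using False assms by (simp add: a_def)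
  have "((\<lambda>t. 1 / (\<i> * of_real a) * cis (a * t)) has_vector_derivative cis (a * t))
      (at t within {0..T})" for t
    using has_vector_derivative_mult_right[OF cis_has_vector_derivative[of a t "{0..T}"],
        of "1 / (\<i> * of_real a)"] a by simp
  then have "((\<lambda>t. cis (a * t)) has_integral
      (1 / (\<i> * of_real a)) * cis (a * T) - (1 / (\<i> * of_real a)) * cis (a * 0)) {0..T}"
    using assms by (intro fundamental_theorem_of_calculus) auto
  moreover have "cis (a * T) = 1"
    using cis_multiple_2pi[of "of_int m"] assms by (simp add: a_def mult.commute)
  ultimately show ?thesis using False by (simp add: a_def)
qed

text \<open>
  Expand \<open>0 \<le> \<integral> \<parallel>g - \<Sum> cis (w\<^sub>n t) c\<^sub>n\<parallel>\<^sup>2\<close>. The Fourier coefficients \<open>c\<^sub>n\<close> are characterised weakly, by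
  testing against vectors, so that only complex-valued integrals occur.
\<close>

lemma Bessel_inequality_periodic:
  fixes g :: "real \<Rightarrow> 'y::complex_hilbert" and c :: "int \<Rightarrow> 'y"
  assumes T: "T > 0" and g: "continuous_on {0..T} g" and F: "finite F"
    and c: "\<And>n y. n \<in> F \<Longrightarrow>
      ((\<lambda>t. cis (- (2 * pi * of_int n / T * t)) * cinner (g t) y) has_integral of_real T * cinner (c n) y) {0..T}"
  shows "T * (\<Sum>n\<in>F. (norm (c n))\<^sup>2) \<le> integral {0..T} (\<lambda>t. (norm (g t))\<^sup>2)"
proof -
  define w where "w n = 2 * pi * of_int n / T" for n :: int
  define h where "h t = (\<Sum>n\<in>F. cis (w n * t) *\<^sub>C c n)" for t
  define E where "E = (\<Sum>n\<in>F. (norm (c n))\<^sup>2)"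
  have "((\<lambda>t. Re (cinner (g t) (h t))) has_integral Re (\<Sum>n\<in>F. of_real T * cinner (c n) (c n))) {0..T}"
  proof (rule has_integral_Re)
    have "((\<lambda>t. \<Sum>n\<in>F. cis (- (w n * t)) * cinner (g t) (c n)) has_integral
        (\<Sum>n\<in>F. of_real T * cinner (c n) (c n))) {0..T}"
      unfolding w_def by (intro has_integral_sum F c)
    then show "((\<lambda>t. cinner (g t) (h t)) has_integral (\<Sum>n\<in>F. of_real T * cinner (c n) (c n))) {0..T}"
      by (simp add: h_def cinner_sum_right cinner_scaleC_right cis_cnj)
  qed
  also have "Re (\<Sum>n\<in>F. of_real T * cinner (c n) (c n)) = T * E"
    by (simp add: E_def cinner_self sum_distrib_left del: of_real_power)
  finally have cross: "((\<lambda>t. Re (cinner (g t) (h t))) has_integral T * E) {0..T}" .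
  have hh: "(norm (h t))\<^sup>2 = Re (\<Sum>n\<in>F. \<Sum>m\<in>F. cinner (c n) (c m) * cis (2 * pi * of_int (n - m) / T * t))" for t
  proof -
    have "cis (2 * pi * of_int (n - m) / T * t) = cis (w n * t) * cnj (cis (w m * t))" for n m
      by (simp add: cis_cnj cis_mult w_def algebra_simps diff_divide_distrib)
    moreover have "(norm (h t))\<^sup>2 = Re (cinner (h t) (h t))"
      by (simp add: cinner_self del: of_real_power)
    moreover have "cinner (h t) (h t) =
        (\<Sum>n\<in>F. \<Sum>m\<in>F. cinner (c n) (c m) * (cis (w n * t) * cnj (cis (w m * t))))"
      by (simp add: h_def cinner_sum_left cinner_sum_right cinner_scaleC_left cinner_scaleC_right
          sum_distrib_left mult_ac del: cis_mult) (rule sum.swap)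
    ultimately show ?thesis by simp
  qed
  have "((\<lambda>t. (norm (h t))\<^sup>2) has_integral
      Re (\<Sum>n\<in>F. \<Sum>m\<in>F. cinner (c n) (c m) * (if n - m = 0 then of_real T else 0))) {0..T}"
    unfolding hh
    by (intro has_integral_Re has_integral_sum F has_integral_mult_right integral_cis_period T)
  also have "(\<Sum>n\<in>F. \<Sum>m\<in>F. cinner (c n) (c m) * (if n - m = 0 then of_real T else 0))
      = (\<Sum>n\<in>F. \<Sum>m\<in>F. if m = n then cinner (c n) (c n) * of_real T else 0)"
    by (intro sum.cong refl) auto
  also have "Re \<dots> = T * E"
    using F by (simp add: E_def cinner_self sum_distrib_left mult.commute del: of_real_power)
  finally have square: "((\<lambda>t. (norm (h t))\<^sup>2) has_integral T * E) {0..T}" .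
  have "((\<lambda>t. (norm (g t))\<^sup>2) has_integral integral {0..T} (\<lambda>t. (norm (g t))\<^sup>2)) {0..T}"
    by (intro integrable_integral integrable_continuous_real continuous_intros g)
  from has_integral_add[OF has_integral_diff[OF this has_integral_mult_right[OF cross, of 2]] square]
  have "((\<lambda>t. (norm (g t - h t))\<^sup>2) has_integral
      integral {0..T} (\<lambda>t. (norm (g t))\<^sup>2) - 2 * (T * E) + T * E) {0..T}"
    by (simp add: norm_diff_sq)
  from has_integral_nonneg[OF this] show ?thesis
    by (simp add: E_def)
qed

section \<open>Fourier coefficients of windowed exponentials\<close>

text \<open>
  The window vanishes at both ends of \<open>[0, T]\<close>, so that integration by parts turns the factor \<open>\<nu>\<close>
  into a derivative of the window without boundary terms.
\<close>

definition window_transform :: "real \<Rightarrow> real \<Rightarrow> complex" where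
  "window_transform T \<nu> = integral {0..T} (\<lambda>t. of_real (sin (pi * t / T)) * cis (\<nu> * t)) / of_real T"

lemma window_transform_has_integral:
  assumes "T > 0"
  shows "((\<lambda>t. of_real (sin (pi * t / T)) * cis (\<nu> * t)) has_integral
      of_real T * window_transform T \<nu>) {0..T}"
proof -
  have "(\<lambda>t. of_real (sin (pi * t / T)) * cis (\<nu> * t)) integrable_on {0..T}"
    using assms by (intro integrable_continuous_real continuous_intros) auto
  then show ?thesis
    using assms by (simp add: window_transform_def integrable_integral)
qed

lemma window_transform_derivative_has_integral:
  assumes "T > 0"
  shows "((\<lambda>t. of_real (pi / T * cos (pi * t / T)) * cis (\<nu> * t)) has_integral
      of_real T * (- \<i> * of_real \<nu> * window_transform T \<nu>)) {0..T}"
proof -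
  have "((\<lambda>t. complex_of_real (sin (pi * t / T)) * cis (\<nu> * t)) has_vector_derivative
      of_real (sin (pi * t / T)) * (\<i> * of_real \<nu> * cis (\<nu> * t))
        + of_real (pi / T * cos (pi * t / T)) * cis (\<nu> * t)) (at t within {0..T})" for t
    using assms
    by (intro has_vector_derivative_mult cis_has_vector_derivative has_vector_derivative_of_real)
      (auto intro!: derivative_eq_intros simp: has_real_derivative_iff_has_vector_derivative[symmetric])
  then have "((\<lambda>t. of_real (sin (pi * t / T)) * (\<i> * of_real \<nu> * cis (\<nu> * t))
        + of_real (pi / T * cos (pi * t / T)) * cis (\<nu> * t)) has_integral
      complex_of_real (sin (pi * T / T)) * cis (\<nu> * T) - complex_of_real (sin (pi * 0 / T)) * cis (\<nu> * 0)) {0..T}"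
    using assms by (intro fundamental_theorem_of_calculus) auto
  then have "((\<lambda>t. of_real (sin (pi * t / T)) * (\<i> * of_real \<nu> * cis (\<nu> * t))
        + of_real (pi / T * cos (pi * t / T)) * cis (\<nu> * t)) has_integral 0) {0..T}"
    using assms by simp
  from has_integral_diff[OF this has_integral_mult_right[OF
        window_transform_has_integral[OF assms, of \<nu>], of "\<i> * of_real \<nu>"]]
  show ?thesis by (simp add: algebra_simps)
qed

lemma has_integral_sin_cos_sq_window:
  assumes "T > 0"
  shows "((\<lambda>t. (sin (pi * t / T))\<^sup>2) has_integral T / 2) {0..T}"
    and "((\<lambda>t. (cos (pi * t / T))\<^sup>2) has_integral T / 2) {0..T}"
proof -
  have "((\<lambda>t. Re (cis (2 * pi * of_int 1 / T * t))) has_integral Re 0) {0..T}"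
    using has_integral_Re[OF integral_cis_period[OF assms, of 1]] by simp
  then have C: "((\<lambda>t. cos (2 * (pi * t / T))) has_integral 0) {0..T}"
    by (simp add: field_simps)
  have I: "((\<lambda>t. 1 / 2) has_integral T / 2) {0..T}"
    using has_integral_const_real[of "1 / 2 :: real" 0 T] assms by simp
  have "(\<lambda>t. (sin (pi * t / T))\<^sup>2) = (\<lambda>t. 1 / 2 - 1 / 2 * cos (2 * (pi * t / T)))"
    by (rule ext) (simp only: cos_double_sin, simp add: field_simps)
  then show "((\<lambda>t. (sin (pi * t / T))\<^sup>2) has_integral T / 2) {0..T}"
    using has_integral_diff[OF I has_integral_mult_right[OF C, of "1/2"]] by simp
  have "(\<lambda>t. (cos (pi * t / T))\<^sup>2) = (\<lambda>t. 1 / 2 + 1 / 2 * cos (2 * (pi * t / T)))"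
    by (rule ext) (simp only: cos_double_cos, simp add: field_simps)
  then show "((\<lambda>t. (cos (pi * t / T))\<^sup>2) has_integral T / 2) {0..T}"
    using has_integral_add[OF I has_integral_mult_right[OF C, of "1/2"]] by simp
qed

lemma Re_complex_of_real_mult_cis: "Re (of_real r * cis x) = r * cos x"
  by simp

text \<open>
  After the phase shift that centres the exponential at \<open>T / 2\<close>, its real part \<open>cos (\<nu> (t - T / 2))\<close>
  dominates \<open>cos (\<pi> / T (t - T / 2)) = sin (\<pi> t / T)\<close>, which is the window itself.
\<close>

lemma window_transform_lower:
  assumes T: "T > 0" and \<nu>: "\<bar>\<nu>\<bar> \<le> pi / T"
  shows "1 / 2 \<le> cmod (window_transform T \<nu>)"
proof -
  have "((\<lambda>t. Re (cis (- (\<nu> * T / 2)) * (of_real (sin (pi * t / T)) * cis (\<nu> * t)))) has_integral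
      Re (cis (- (\<nu> * T / 2)) * (of_real T * window_transform T \<nu>))) {0..T}"
    by (intro has_integral_Re has_integral_mult_right window_transform_has_integral T)
  moreover have "Re (cis (- (\<nu> * T / 2)) * (of_real (sin (pi * t / T)) * cis (\<nu> * t)))
      = sin (pi * t / T) * cos (\<nu> * (t - T / 2))" for t
  proof -
    have "cis (- (\<nu> * T / 2)) * cis (\<nu> * t) = cis (\<nu> * (t - T / 2))"
      by (simp add: cis_mult algebra_simps)
    then have "cis (- (\<nu> * T / 2)) * (of_real (sin (pi * t / T)) * cis (\<nu> * t))
        = of_real (sin (pi * t / T)) * cis (\<nu> * (t - T / 2))"
      by (simp only: mult.left_commute)
    then show ?thesis by (metis Re_complex_of_real_mult_cis)
  qed
  ultimately have I: "((\<lambda>t. sin (pi * t / T) * cos (\<nu> * (t - T / 2))) has_integral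
      Re (cis (- (\<nu> * T / 2)) * (of_real T * window_transform T \<nu>))) {0..T}" by simp
  have "(sin (pi * t / T))\<^sup>2 \<le> sin (pi * t / T) * cos (\<nu> * (t - T / 2))" if t: "t \<in> {0..T}" for t
  proof -
    have "\<bar>\<nu> * (t - T / 2)\<bar> \<le> pi / T * \<bar>t - T / 2\<bar>"
      unfolding abs_mult using \<nu> by (rule mult_right_mono) simp
    moreover have "\<bar>t - T / 2\<bar> \<le> T / 2" using t unfolding abs_le_iff by auto
    then have "pi / T * \<bar>t - T / 2\<bar> \<le> pi / T * (T / 2)"
      using T by (intro mult_left_mono) auto
    then have "pi / T * \<bar>t - T / 2\<bar> \<le> pi" proof (rule order_trans)
      show "pi / T * (T / 2) \<le> pi" using T by simp
    qed
    ultimately have "cos (pi / T * \<bar>t - T / 2\<bar>) \<le> cos \<bar>\<nu> * (t - T / 2)\<bar>"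
      using T by (intro cos_monotone_0_pi_le) simp_all
    moreover have "cos (pi / T * \<bar>t - T / 2\<bar>) = sin (pi * t / T)"
    proof -
      have "cos (pi / T * \<bar>t - T / 2\<bar>) = cos \<bar>pi / T * (t - T / 2)\<bar>"
        using T by (simp add: abs_mult)
      also have "\<dots> = cos (pi * t / T - pi / 2)"
        using T by (simp only: cos_abs_real) (simp add: field_simps)
      also have "\<dots> = sin (pi * t / T)" by (simp add: cos_diff)
      finally show ?thesis .
    qed
    moreover have "0 \<le> sin (pi * t / T)"
      using t T by (intro sin_ge_zero) (auto simp: field_simps)
    ultimately show ?thesis
      by (simp add: power2_eq_square mult_left_mono)
  qed
  from has_integral_le[OF has_integral_sin_cos_sq_window(1)[OF T] I this]
  have "T / 2 \<le> Re (cis (- (\<nu> * T / 2)) * (of_real T * window_transform T \<nu>))" .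
  also have "\<dots> \<le> cmod (cis (- (\<nu> * T / 2)) * (of_real T * window_transform T \<nu>))"
    by (rule complex_Re_le_cmod)
  also have "\<dots> = T * cmod (window_transform T \<nu>)" using T by (simp add: norm_mult)
  finally show ?thesis using T by simp
qed

lemma exists_near_grid_frequency:
  assumes "T > 0"
  shows "\<exists>n::int. \<bar>\<mu> - 2 * pi * of_int n / T\<bar> \<le> pi / T"
proof -
  define n where "n = round (\<mu> * T / (2 * pi))"
  have "\<bar>\<mu> * T / (2 * pi) - of_int n\<bar> \<le> 1 / 2"
    using of_int_round_abs_le[of "\<mu> * T / (2 * pi)"] by (simp add: n_def abs_minus_commute)
  then have "2 * pi / T * \<bar>\<mu> * T / (2 * pi) - of_int n\<bar> \<le> 2 * pi / T * (1 / 2)"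
    using assms by (intro mult_left_mono) auto
  also have "2 * pi / T * \<bar>\<mu> * T / (2 * pi) - of_int n\<bar>
      = \<bar>2 * pi / T * (\<mu> * T / (2 * pi) - of_int n)\<bar>"
    using assms by (simp only: abs_mult) simp
  also have "2 * pi / T * (\<mu> * T / (2 * pi) - of_int n) = \<mu> - 2 * pi * of_int n / T"
    using assms by (simp add: field_simps)
  finally show ?thesis by auto
qed

lemma cis_modulation: "cis (- (2 * pi * of_int n / T * t)) * (x * cis (\<nu> * t)) = x * cis ((\<nu> - 2 * pi * of_int n / T) * t)"
  by (simp add: cis_mult algebra_simps)

text \<open>
  The vectors on the left are the Fourier coefficients of the windowed signal, and the window is at
  most one in modulus.
\<close>

lemma window_Bessel:
  fixes y :: "'k \<Rightarrow> 'y::complex_hilbert" and \<mu> :: "'k \<Rightarrow> real"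
  assumes T: "T > 0" and F: "finite F" and K: "finite K"
  shows "T * (\<Sum>n\<in>F. (norm (\<Sum>k\<in>K. (window_transform T (\<mu> k - 2 * pi * of_int n / T) * a k) *\<^sub>C y k))\<^sup>2)
    \<le> integral {0..T} (\<lambda>t. (norm (\<Sum>k\<in>K. (cis (\<mu> k * t) * a k) *\<^sub>C y k))\<^sup>2)"
proof -
  let ?f = "\<lambda>t. \<Sum>k\<in>K. (cis (\<mu> k * t) * a k) *\<^sub>C y k"
  let ?g = "\<lambda>t. \<Sum>k\<in>K. (of_real (sin (pi * t / T)) * cis (\<mu> k * t) * a k) *\<^sub>C y k"
  have "T * (\<Sum>n\<in>F. (norm (\<Sum>k\<in>K. (window_transform T (\<mu> k - 2 * pi * of_int n / T) * a k) *\<^sub>C y k))\<^sup>2)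
    \<le> integral {0..T} (\<lambda>t. (norm (?g t))\<^sup>2)"
  proof (rule Bessel_inequality_periodic[OF T _ F])
    show "continuous_on {0..T} ?g" using T by (intro continuous_intros) auto
    fix n z
    have "((\<lambda>t. \<Sum>k\<in>K. of_real (sin (pi * t / T)) * cis ((\<mu> k - 2 * pi * of_int n / T) * t) * (a k * cinner (y k) z))
      has_integral (\<Sum>k\<in>K. of_real T * window_transform T (\<mu> k - 2 * pi * of_int n / T) * (a k * cinner (y k) z))) {0..T}"
      by (intro has_integral_sum K has_integral_mult_left window_transform_has_integral T)
    then show "((\<lambda>t. cis (- (2 * pi * of_int n / T * t)) * cinner (?g t) z) has_integral
        of_real T * cinner (\<Sum>k\<in>K. (window_transform T (\<mu> k - 2 * pi * of_int n / T) * a k) *\<^sub>C y k) z) {0..T}"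
      unfolding cis_modulation[symmetric]
      by (simp add: cinner_sum_left cinner_scaleC_left sum_distrib_left mult_ac)
  qed
  also have "\<dots> \<le> integral {0..T} (\<lambda>t. (norm (?f t))\<^sup>2)"
  proof (rule integral_le)
    show "(\<lambda>t. (norm (?g t))\<^sup>2) integrable_on {0..T}" "(\<lambda>t. (norm (?f t))\<^sup>2) integrable_on {0..T}"
      using T by (intro integrable_continuous_real continuous_intros; simp)+
    fix t
    have "?g t = of_real (sin (pi * t / T)) *\<^sub>C ?f t"
      by (simp add: scaleC_sum_right scaleC_scaleC mult_ac)
    then have "norm (?g t) \<le> norm (?f t)"
      by (simp add: norm_scaleC mult_left_le_one_le)
    then show "(norm (?g t))\<^sup>2 \<le> (norm (?f t))\<^sup>2" by (simp add: power_mono)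
  qed
  finally show ?thesis .
qed

text \<open>
  Bessel's inequality for the windowed exponential, and for the derivative of the window times the
  exponential.
\<close>

lemma window_transform_energy:
  assumes T: "T > 0" and F: "finite F"
  shows "(\<Sum>n\<in>F. (cmod (window_transform T (\<nu> - 2 * pi * of_int n / T)))\<^sup>2) \<le> 1 / 2" (is "?A \<le> _")
    and "(\<Sum>n\<in>F. (\<nu> - 2 * pi * of_int n / T)\<^sup>2 * (cmod (window_transform T (\<nu> - 2 * pi * of_int n / T)))\<^sup>2)
      \<le> pi\<^sup>2 / (2 * T\<^sup>2)" (is "?B \<le> _")
proof -
  let ?g = "\<lambda>t. of_real (sin (pi * t / T)) * cis (\<nu> * t)"
  have "T * (\<Sum>n\<in>F. (cmod (window_transform T (\<nu> - 2 * pi * of_int n / T)))\<^sup>2) \<le> integral {0..T} (\<lambda>t. (norm (?g t))\<^sup>2)"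
  proof (rule Bessel_inequality_periodic[OF T _ F])
    show "continuous_on {0..T} ?g" using T by (intro continuous_intros) auto
    fix n z
    show "((\<lambda>t. cis (- (2 * pi * of_int n / T * t)) * cinner (?g t) z) has_integral
        of_real T * cinner (window_transform T (\<nu> - 2 * pi * of_int n / T)) z) {0..T}"
      using has_integral_mult_left[OF window_transform_has_integral[OF T, of "\<nu> - 2 * pi * of_int n / T"], of "cnj z"]
      unfolding cinner_complex_def cis_modulation[symmetric] by (simp add: mult_ac)
  qed
  also have "\<dots> = T / 2"
    using integral_unique[OF has_integral_sin_cos_sq_window(1)[OF T]] by (simp add: norm_mult)
  finally show "?A \<le> 1 / 2" using T by simp
  let ?h = "\<lambda>t. of_real (pi / T * cos (pi * t / T)) * cis (\<nu> * t)"
  have "T * (\<Sum>n\<in>F. (cmod (- \<i> * of_real (\<nu> - 2 * pi * of_int n / T) * window_transform T (\<nu> - 2 * pi * of_int n / T)))\<^sup>2)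
      \<le> integral {0..T} (\<lambda>t. (norm (?h t))\<^sup>2)"
  proof (rule Bessel_inequality_periodic[OF T _ F])
    show "continuous_on {0..T} ?h" using T by (intro continuous_intros) auto
    fix n z
    show "((\<lambda>t. cis (- (2 * pi * of_int n / T * t)) * cinner (?h t) z) has_integral
        of_real T * cinner (- \<i> * of_real (\<nu> - 2 * pi * of_int n / T) * window_transform T (\<nu> - 2 * pi * of_int n / T)) z) {0..T}"
      using has_integral_mult_left[OF window_transform_derivative_has_integral[OF T, of "\<nu> - 2 * pi * of_int n / T"], of "cnj z"]
      unfolding cinner_complex_def cis_modulation[symmetric] by (simp add: mult_ac)
  qed
  also have "integral {0..T} (\<lambda>t. (norm (?h t))\<^sup>2) = pi\<^sup>2 / T\<^sup>2 * (T / 2)"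
    using integral_unique[OF has_integral_mult_right[OF has_integral_sin_cos_sq_window(2)[OF T], of "pi\<^sup>2 / T\<^sup>2"]]
    by (simp add: norm_mult norm_divide power_mult_distrib power_divide)
  also have "\<dots> = T * (pi\<^sup>2 / (2 * T\<^sup>2))" by (simp add: mult_ac)
  finally show "?B \<le> pi\<^sup>2 / (2 * T\<^sup>2)"
    by (simp only: norm_mult power_mult_distrib norm_of_real power2_abs norm_minus_cancel
        norm_ii mult_1_left power_one mult_le_cancel_left_pos[OF T])
qed

section \<open>The classes of weight functions and the observation time\<close>

lemma Sigma_d_pos: "f \<in> Sigma_d \<Longrightarrow> 0 < f x"
  by (simp add: Sigma_d_def)

lemma Sigma_d_antimono: "f \<in> Sigma_d \<Longrightarrow> 0 \<le> x \<Longrightarrow> x \<le> y \<Longrightarrow> f y \<le> f x"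
  by (auto simp: Sigma_d_def monotone_on_def)

lemma Sigma_d_isCont: "f \<in> Sigma_d \<Longrightarrow> isCont f x"
  by (simp add: Sigma_d_def continuous_on_eq_continuous_at)

lemma Sigma_i_pos: "f \<in> Sigma_i \<Longrightarrow> 0 < f x"
  by (simp add: Sigma_i_def)

lemma Sigma_i_mono: "f \<in> Sigma_i \<Longrightarrow> 0 \<le> x \<Longrightarrow> x \<le> y \<Longrightarrow> f x \<le> f y"
  by (auto simp: Sigma_i_def monotone_on_def)

lemma Sigma_d_divide:
  assumes f: "f \<in> Sigma_d" and g: "g \<in> Sigma_i"
  shows "(\<lambda>x. f x / g x) \<in> Sigma_d"
proof -
  have "f y / g y \<le> f x / g x" if "0 \<le> x" "x \<le> y" for x y
    using that by (intro frac_le Sigma_d_antimono[OF f] Sigma_i_mono[OF g] Sigma_i_pos[OF g]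
        less_imp_le[OF Sigma_d_pos[OF f]])
  then show ?thesis
    using f g Sigma_i_pos[OF g] unfolding Sigma_d_def Sigma_i_def
    by (auto simp: monotone_on_def less_imp_neq[THEN not_sym] intro!: continuous_intros)
qed

lemma obs_time_lhs_strict_mono:
  assumes \<epsilon>: "\<epsilon> \<in> Sigma_d" and "\<theta>0 > 0" "l \<ge> 0" "0 < T" "T < T'"
  shows "T * \<epsilon> (\<theta>0 * (1 / T + l)) < T' * \<epsilon> (\<theta>0 * (1 / T' + l))"
proof -
  have "\<epsilon> (\<theta>0 * (1 / T + l)) \<le> \<epsilon> (\<theta>0 * (1 / T' + l))"
    using \<epsilon> assms(2-) unfolding Sigma_d_def
    by (auto intro!: monotone_onD[of "{0..}" "(\<le>)" "(\<ge>)" \<epsilon>, simplified] mult_left_mono simp: frac_le)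
  moreover have "0 < \<epsilon> (\<theta>0 * (1 / T + l))" using \<epsilon> by (simp add: Sigma_d_def)
  ultimately show ?thesis using assms by (intro mult_less_le_imp_less) auto
qed

lemma obs_time_exists_unique:
  assumes \<epsilon>: "\<epsilon> \<in> Sigma_d" and th: "\<theta>0 > 0" "\<theta>1 > 0" and l: "l \<ge> 0"
  shows "\<exists>!T. obs_time_eq \<epsilon> \<theta>0 \<theta>1 l T"
proof (rule ex_ex1I)
  let ?F = "\<lambda>T. T * \<epsilon> (\<theta>0 * (1 / T + l))"
  \<comment> \<open>since \<open>\<epsilon>\<close> is largest at 0, the left-hand side is at most \<open>\<theta>1\<close> at \<open>a\<close>\<close>
  define a where "a = \<theta>1 / \<epsilon> 0"
  \<comment> \<open>for \<open>T \<ge> 1\<close> the argument of \<open>\<epsilon>\<close> is at most \<open>\<theta>0 * (1 + l)\<close>\<close>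
  define b where "b = max (max a 1) (\<theta>1 / \<epsilon> (\<theta>0 * (1 + l)))"
  have a: "a > 0" using th Sigma_d_pos[OF \<epsilon>] by (simp add: a_def)
  have b: "a \<le> b" "1 \<le> b" "\<theta>1 / \<epsilon> (\<theta>0 * (1 + l)) \<le> b" by (auto simp: b_def)
  have "\<epsilon> (\<theta>0 * (1 / a + l)) \<le> \<epsilon> 0" using th l a by (intro Sigma_d_antimono[OF \<epsilon>]) auto
  then have "?F a \<le> a * \<epsilon> 0" using a by (intro mult_left_mono) auto
  also have "\<dots> = \<theta>1" using Sigma_d_pos[OF \<epsilon>, of 0] by (simp add: a_def)
  finally have Fa: "?F a \<le> \<theta>1" .
  have "\<theta>1 = \<theta>1 / \<epsilon> (\<theta>0 * (1 + l)) * \<epsilon> (\<theta>0 * (1 + l))"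
    using Sigma_d_pos[OF \<epsilon>, of "\<theta>0 * (1 + l)"] by simp
  also have "\<dots> \<le> b * \<epsilon> (\<theta>0 * (1 / b + l))"
    using b th l Sigma_d_pos[OF \<epsilon>, of "\<theta>0 * (1 + l)"]
    by (intro mult_mono Sigma_d_antimono[OF \<epsilon>] mult_left_mono) auto
  finally have Fb: "\<theta>1 \<le> ?F b" .
  have "continuous_on {a..b} ?F"
    using a by (intro continuous_at_imp_continuous_on ballI continuous_intros
        isCont_o2[OF _ Sigma_d_isCont[OF \<epsilon>]]) auto
  from IVT'[OF Fa Fb b(1) this] show "\<exists>T. obs_time_eq \<epsilon> \<theta>0 \<theta>1 l T"
    using a unfolding obs_time_eq_def by (metis less_le_trans)
next
  fix T T' assume "obs_time_eq \<epsilon> \<theta>0 \<theta>1 l T" "obs_time_eq \<epsilon> \<theta>0 \<theta>1 l T'"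
  then show "T = T'"
    using obs_time_lhs_strict_mono[OF \<epsilon> th(1) l, of T T'] obs_time_lhs_strict_mono[OF \<epsilon> th(1) l, of T' T]
    unfolding obs_time_eq_def by (cases T T' rule: linorder_cases) auto
qed

text \<open>
  By strict monotonicity in \<open>T\<close> of the left-hand side of its defining equation, comparing the
  observation time with a constant is an inequality for \<open>\<epsilon>\<close>. Both conditions are open in \<open>l\<close>, which
  gives continuity of the observation time without an implicit function theorem.
\<close>

lemma obs_time_less_iff:
  assumes \<epsilon>: "\<epsilon> \<in> Sigma_d" and th: "\<theta>0 > 0" "\<theta>1 > 0" and c: "c > 0"
  shows "obs_time \<epsilon> \<theta>0 \<theta>1 l < c \<longleftrightarrow> \<theta>1 < c * \<epsilon> (\<theta>0 * (1 / c + \<bar>l\<bar>))"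
    and "c < obs_time \<epsilon> \<theta>0 \<theta>1 l \<longleftrightarrow> c * \<epsilon> (\<theta>0 * (1 / c + \<bar>l\<bar>)) < \<theta>1"
    and "obs_time \<epsilon> \<theta>0 \<theta>1 l > 0"
proof -
  have "obs_time_eq \<epsilon> \<theta>0 \<theta>1 \<bar>l\<bar> (obs_time \<epsilon> \<theta>0 \<theta>1 l)"
    unfolding obs_time_def by (rule theI'[OF obs_time_exists_unique[OF \<epsilon> th abs_ge_zero]])
  then have T: "obs_time \<epsilon> \<theta>0 \<theta>1 l > 0"
    "obs_time \<epsilon> \<theta>0 \<theta>1 l * \<epsilon> (\<theta>0 * (1 / obs_time \<epsilon> \<theta>0 \<theta>1 l + \<bar>l\<bar>)) = \<theta>1"
    by (auto simp: obs_time_eq_def)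
  note m = obs_time_lhs_strict_mono[OF \<epsilon> th(1) abs_ge_zero, of _ _ l]
  show "obs_time \<epsilon> \<theta>0 \<theta>1 l < c \<longleftrightarrow> \<theta>1 < c * \<epsilon> (\<theta>0 * (1 / c + \<bar>l\<bar>))"
    "c < obs_time \<epsilon> \<theta>0 \<theta>1 l \<longleftrightarrow> c * \<epsilon> (\<theta>0 * (1 / c + \<bar>l\<bar>)) < \<theta>1"
    using m[OF T(1), of c] m[OF c, of "obs_time \<epsilon> \<theta>0 \<theta>1 l"] T
    by (cases c "obs_time \<epsilon> \<theta>0 \<theta>1 l" rule: linorder_cases; force)+
  show "obs_time \<epsilon> \<theta>0 \<theta>1 l > 0" by (rule T(1))
qed

lemma obs_time_Sigma_i:
  assumes \<epsilon>: "\<epsilon> \<in> Sigma_d" and th: "\<theta>0 > 0" "\<theta>1 > 0"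
  shows "obs_time \<epsilon> \<theta>0 \<theta>1 \<in> Sigma_i"
proof -
  let ?T = "obs_time \<epsilon> \<theta>0 \<theta>1"
  note iff = obs_time_less_iff[OF \<epsilon> th]
  have pos: "0 < ?T l" for l by (rule iff(3)[OF zero_less_one])
  have "isCont (\<lambda>l. c * \<epsilon> (\<theta>0 * (1 / c + \<bar>l\<bar>))) l" for c l
    by (intro continuous_intros isCont_o2[OF _ Sigma_d_isCont[OF \<epsilon>]])
  then have cont: "((\<lambda>l. c * \<epsilon> (\<theta>0 * (1 / c + \<bar>l\<bar>))) \<longlongrightarrow> c * \<epsilon> (\<theta>0 * (1 / c + \<bar>l\<bar>))) (at l)" for c l
    unfolding isCont_def .
  have "isCont ?T l" for l
    unfolding isCont_def
  proof (rule order_tendstoI)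
    fix c assume c: "c < ?T l"
    show "eventually (\<lambda>x. c < ?T x) (at l)"
    proof (cases "c > 0")
      case True
      show ?thesis using order_tendstoD(2)[OF cont[of c l]] c iff(2)[OF True] by auto
    next
      case False
      then show ?thesis using pos by (intro always_eventually allI) (metis le_less_trans not_less)
    qed
  next
    fix c assume c: "?T l < c"
    then have "c > 0" using pos[of l] by simp
    then show "eventually (\<lambda>x. ?T x < c) (at l)"
      using order_tendstoD(1)[OF cont[of c l]] c iff(1) by auto
  qed
  moreover have "?T x \<le> ?T y" if "0 \<le> x" "x \<le> y" for x y
  proof (rule ccontr)
    assume "\<not> ?T x \<le> ?T y"
    then have "?T y < ?T x" by simp
    then have "?T y * \<epsilon> (\<theta>0 * (1 / ?T y + \<bar>x\<bar>)) < \<theta>1" using iff(2)[OF pos[of y]] by blast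
    moreover have "\<theta>1 \<le> ?T y * \<epsilon> (\<theta>0 * (1 / ?T y + \<bar>y\<bar>))" using iff(2)[OF pos[of y], of y] by simp
    moreover have "\<epsilon> (\<theta>0 * (1 / ?T y + \<bar>y\<bar>)) \<le> \<epsilon> (\<theta>0 * (1 / ?T y + \<bar>x\<bar>))"
      using that th pos[of y] by (intro Sigma_d_antimono[OF \<epsilon>] mult_left_mono) auto
    ultimately show False using pos[of y] by (smt (verit) mult_left_mono)
  qed
  moreover have "?T (- x) = ?T x" for x by (simp add: obs_time_def)
  ultimately show ?thesis
    using pos by (auto simp: Sigma_i_def continuous_on_eq_continuous_at monotone_on_def)
qed

section \<open>The energy space and the eigenbasis of the generator\<close>

locale wave_system =
  fixes A0 S :: "'h::complex_hilbert \<Rightarrow> 'h" and D0 D1 :: "'h set"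
    and lam :: "nat \<Rightarrow> real" and \<phi> :: "nat \<Rightarrow> 'h"
    and C0 :: "'h \<Rightarrow> 'y::complex_hilbert"
    and U :: "real \<Rightarrow> 'h \<times> 'h \<Rightarrow> 'h \<times> 'h"
  assumes A0: "self_adjoint D0 A0"
    and S: "operator_sqrt D0 A0 D1 S"
    and basis: "eigenbasis D1 S lam \<phi>"
    and C0: "obs_bounded D0 A0 C0"
    and U: "isometry_group_generated_by D0 A0 D1 S U"
    and adm: "admissible D0 D1 S C0 U"
begin

text \<open>
  The isometry of the energy space onto \<open>H \<times> H\<close> with its product inner product.
\<close>

definition J :: "'h \<times> 'h \<Rightarrow> 'h \<times> 'h" where "J z = (S (fst z), snd z)"

abbreviation X where "X \<equiv> X_space D1"
abbreviation DA where "DA \<equiv> A_dom D0 D1"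
abbreviation A where "A \<equiv> A_op A0"
abbreviation C :: "'h \<times> 'h \<Rightarrow> 'y" where "C \<equiv> C_op C0"
abbreviation \<mu> where "\<mu> \<equiv> eig_A lam"
abbreviation \<psi> where "\<psi> \<equiv> eigvec_A lam \<phi>"
abbreviation coeff where "coeff z k \<equiv> X_inner S z (\<psi> k)"
abbreviation freq where "freq \<equiv> freq_absA S lam \<phi>"
abbreviation energy where "energy \<equiv> observed_energy C0 U"

lemma S_clinear: "clinear_on D1 S"
  using S by (simp add: operator_sqrt_def self_adjoint_def)

lemma A0_clinear: "clinear_on D0 A0"
  using A0 by (simp add: self_adjoint_def)

lemma D1_csubspace: "csubspace D1" and D0_csubspace: "csubspace D0"
  using S_clinear A0_clinear by (simp_all add: clinear_on_def)

lemma D0_iff: "u \<in> D0 \<longleftrightarrow> u \<in> D1 \<and> S u \<in> D1"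
  using S by (auto simp: operator_sqrt_def)

lemma A0_eq: "u \<in> D0 \<Longrightarrow> A0 u = S (S u)"
  using S by (simp add: operator_sqrt_def)

lemma S_symmetric: "u \<in> D1 \<Longrightarrow> v \<in> D1 \<Longrightarrow> cinner (S u) v = cinner u (S v)"
  using S by (auto simp: operator_sqrt_def self_adjoint_def adjoint_graph_def set_eq_iff)

lemma S_eq_0: "u \<in> D1 \<Longrightarrow> S u = 0 \<Longrightarrow> u = 0"
  using S by (force simp: operator_sqrt_def positive_on_def)

lemma lam_pos: "k \<ge> 1 \<Longrightarrow> 0 < lam k"
  and lam_mono: "1 \<le> j \<Longrightarrow> j \<le> k \<Longrightarrow> lam j \<le> lam k"
  and phi_D1: "k \<ge> 1 \<Longrightarrow> \<phi> k \<in> D1"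
  and S_phi: "k \<ge> 1 \<Longrightarrow> S (\<phi> k) = lam k *\<^sub>R \<phi> k"
  and phi_orthonormal: "j \<ge> 1 \<Longrightarrow> k \<ge> 1 \<Longrightarrow> cinner (\<phi> j) (\<phi> k) = (if j = k then 1 else 0)"
  and phi_expansion: "((\<lambda>k. cinner u (\<phi> k) *\<^sub>C \<phi> k) has_sum u) {1..}"
  using basis by (auto simp: eigenbasis_def)

lemma phi_D0: "k \<ge> 1 \<Longrightarrow> \<phi> k \<in> D0"
  using D1_csubspace by (simp add: D0_iff phi_D1 S_phi scaleR_scaleC csubspace_def)

lemma A0_phi: "k \<ge> 1 \<Longrightarrow> A0 (\<phi> k) = (lam k)\<^sup>2 *\<^sub>R \<phi> k"
  by (simp add: A0_eq phi_D0 S_phi clinear_on_scaleR[OF S_clinear phi_D1] power2_eq_square)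

lemma X_csubspace: "csubspace X" and DA_csubspace: "csubspace DA" and DA_subset_X: "DA \<subseteq> X"
  using D1_csubspace D0_csubspace
  by (auto simp: csubspace_def X_space_def A_dom_def D0_iff scaleC_prod_def zero_prod_def)

lemma J_clinear: "clinear_on X J"
  using S_clinear X_csubspace
  by (auto simp: clinear_on_def J_def X_space_def scaleC_prod_def)

lemma J_clinear_DA: "clinear_on DA J"
  using J_clinear DA_csubspace DA_subset_X unfolding clinear_on_def by (meson subsetD)

lemma A_clinear: "clinear_on DA A"
  using A0_clinear DA_csubspace
  by (auto simp: clinear_on_def A_op_def A_dom_def scaleC_prod_def scaleC_add_right scaleC_minus_right
      scaleC_scaleC mult.commute scaleC_diff_right)

lemma C_clinear: "clinear_on DA C"
  using C0 DA_csubspace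
  by (auto simp: clinear_on_def C_op_def A_dom_def scaleC_prod_def obs_bounded_def)

lemma A_in_X: "z \<in> DA \<Longrightarrow> A z \<in> X"
  using D1_csubspace by (auto simp: A_op_def A_dom_def X_space_def scaleC_prod_def csubspace_def)

lemma X_norm_J: "X_norm S z = norm (J z)"
  by (simp add: X_norm_def J_def norm_prod_def)

lemma X_inner_J: "X_inner S z w = cinner (J z) (J w)"
  by (simp add: X_inner_def J_def cinner_prod_def)

lemma J_eq_0: "z \<in> X \<Longrightarrow> J z = 0 \<Longrightarrow> z = 0"
  using S_eq_0 by (auto simp: J_def X_space_def zero_prod_def prod_eq_iff)

lemma X_norm_pos: "z \<in> DA - {0} \<Longrightarrow> 0 < X_norm S z"
  using J_eq_0[of z] DA_subset_X by (auto simp: X_norm_J simp del: split_paired_All)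

lemma C_bounded: "\<exists>M\<ge>0. \<forall>z\<in>DA. norm (C z) \<le> M * X_norm S (A z)"
proof -
  obtain M where M: "\<And>u. u \<in> D0 \<Longrightarrow> norm (C0 u) \<le> M * norm (A0 u)"
    using C0 by (auto simp: obs_bounded_def)
  have "norm (C z) \<le> \<bar>M\<bar> * X_norm S (A z)" if "z \<in> DA" for z
  proof -
    have "norm (C z) \<le> M * norm (A0 (fst z))"
      using M that by (auto simp: C_op_def A_dom_def)
    also have "\<dots> \<le> \<bar>M\<bar> * X_norm S (A z)"
      by (intro mult_mono) (auto simp: X_norm_def A_op_def scaleC_prod_def norm_scaleC)
    finally show ?thesis .
  qed
  then show ?thesis by (intro exI[of _ "\<bar>M\<bar>"]) auto
qed

lemma eig_A_abs: "k \<noteq> 0 \<Longrightarrow> \<bar>\<mu> k\<bar> = lam (nat \<bar>k\<bar>)"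
  using lam_pos[of "nat \<bar>k\<bar>"] by (cases "k > 0") (simp_all add: eig_A_def sgn_if Suc_le_eq)

lemma eig_A_nz: "k \<noteq> 0 \<Longrightarrow> \<mu> k \<noteq> 0"
  using eig_A_abs[of k] lam_pos[of "nat \<bar>k\<bar>"] by (auto simp: Suc_le_eq)

lemma J_psi:
  assumes "k \<noteq> 0"
  shows "J (\<psi> k) = ((- \<i> * of_int (sgn k) / of_real (sqrt 2)) *\<^sub>C \<phi> (nat \<bar>k\<bar>), of_real (1 / sqrt 2) *\<^sub>C \<phi> (nat \<bar>k\<bar>))"
proof -
  have k: "nat \<bar>k\<bar> \<ge> 1" using assms by simp
  have "S (c *\<^sub>C d *\<^sub>C \<phi> (nat \<bar>k\<bar>)) = (c * d * of_real (lam (nat \<bar>k\<bar>))) *\<^sub>C \<phi> (nat \<bar>k\<bar>)" for c d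
    using S_clinear phi_D1[OF k] S_phi[OF k]
    by (simp add: clinear_on_def scaleC_scaleC scaleR_scaleC)
  moreover have "of_real (1 / sqrt 2) * (1 / (\<i> * of_real (\<mu> k))) * of_real (lam (nat \<bar>k\<bar>))
      = - \<i> * of_int (sgn k) / complex_of_real (sqrt 2)"
    using assms lam_pos[OF k] by (simp add: eig_A_def sgn_if field_simps)
  ultimately show ?thesis by (simp add: J_def eigvec_A_def scaleC_prod_def)
qed

lemma psi_DA: "k \<noteq> 0 \<Longrightarrow> \<psi> k \<in> DA"
  using phi_D0[of "nat \<bar>k\<bar>"] phi_D1[of "nat \<bar>k\<bar>"] D0_csubspace D1_csubspace
  by (simp add: eigvec_A_def A_dom_def scaleC_prod_def csubspace_def)

lemma A_psi:
  assumes "k \<noteq> 0"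
  shows "A (\<psi> k) = of_real (\<mu> k) *\<^sub>C \<psi> k"
proof -
  have k: "nat \<bar>k\<bar> \<ge> 1" using assms by simp
  have "A0 (c *\<^sub>C \<phi> (nat \<bar>k\<bar>)) = (c * of_real ((lam (nat \<bar>k\<bar>))\<^sup>2)) *\<^sub>C \<phi> (nat \<bar>k\<bar>)" for c
    using A0_clinear phi_D0[OF k] A0_phi[OF k]
    by (simp add: clinear_on_def scaleC_scaleC scaleR_scaleC del: of_real_power)
  moreover have "(lam (nat \<bar>k\<bar>))\<^sup>2 = \<mu> k * \<mu> k"
    using eig_A_abs[OF assms] by (metis power2_abs power2_eq_square)
  ultimately show ?thesis
    using eig_A_nz[OF assms]
    by (simp add: A_op_def eigvec_A_def scaleC_prod_def scaleC_scaleC scaleC_minus_right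
        scaleC_minus_left[symmetric] field_simps)
      (intro arg_cong2[where f = scaleC], simp_all add: divide_simps)
qed

lemma coeff_eq:
  assumes "k \<noteq> 0"
  shows "coeff z k = (\<i> * of_int (sgn k) * cinner (S (fst z)) (\<phi> (nat \<bar>k\<bar>)) + cinner (snd z) (\<phi> (nat \<bar>k\<bar>))) / of_real (sqrt 2)"
  unfolding X_inner_J J_psi[OF assms]
  by (simp add: J_def cinner_prod_def cinner_scaleC_right add_divide_distrib)

lemma psi_orthonormal:
  assumes "j \<noteq> 0" "k \<noteq> 0"
  shows "cinner (J (\<psi> j)) (J (\<psi> k)) = (if j = k then 1 else 0)"
proof -
  have s: "complex_of_real (sqrt 2) * complex_of_real (sqrt 2) = 2"
    by (simp add: of_real_mult[symmetric] del: of_real_mult)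
  have "cinner (\<phi> (nat \<bar>j\<bar>)) (\<phi> (nat \<bar>k\<bar>)) = (if \<bar>j\<bar> = \<bar>k\<bar> then 1 else 0)"
    using assms by (subst phi_orthonormal) auto
  then show ?thesis
    using assms unfolding J_psi[OF assms(1)] J_psi[OF assms(2)]
    by (auto simp: cinner_prod_def cinner_scaleC_left cinner_scaleC_right s sgn_if abs_if split: if_splits)
qed

lemma coeff_A:
  assumes z: "z \<in> DA" and k: "k \<noteq> 0"
  shows "coeff (A z) k = of_real (\<mu> k) * coeff z k"
proof -
  have k': "nat \<bar>k\<bar> \<ge> 1" using k by simp
  have D: "fst z \<in> D0" "fst z \<in> D1" "S (fst z) \<in> D1" "snd z \<in> D1"
    using z by (auto simp: A_dom_def D0_iff)
  have "S (fst (A z)) = (- \<i>) *\<^sub>C S (snd z)"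
    using D S_clinear by (simp add: A_op_def scaleC_prod_def clinear_on_def)
  moreover have "snd (A z) = \<i> *\<^sub>C S (S (fst z))"
    using D by (simp add: A_op_def scaleC_prod_def A0_eq scaleC_minus_left scaleC_minus_right)
  moreover have "cinner (S v) (\<phi> (nat \<bar>k\<bar>)) = of_real (lam (nat \<bar>k\<bar>)) * cinner v (\<phi> (nat \<bar>k\<bar>))" if "v \<in> D1" for v
    using that k' by (simp add: S_symmetric phi_D1 S_phi scaleR_scaleC cinner_scaleC_right)
  ultimately show ?thesis
    using D k unfolding coeff_eq[OF k] eig_A_def
    by (simp add: cinner_scaleC_left sgn_if field_simps)
qed

text \<open>
  The positive and the negative indices contribute separately. Half of the expansion of
  \<open>w = S u \<mp> \<i> v\<close> in the \<open>\<phi>\<^sub>k\<close>, embedded as \<open>(w, \<plusminus>\<i> w)\<close>, is the sum over the indices of sign \<open>\<plusminus>\<close>, and the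
  two halves add up to \<open>(S u, v)\<close>.
\<close>

lemma expansion: "((\<lambda>k. coeff z k *\<^sub>C J (\<psi> k)) has_sum J z) (- {0})"
proof -
  have half: "((\<lambda>k. coeff z k *\<^sub>C J (\<psi> k)) has_sum
      of_real (1 / 2) *\<^sub>C (w, (\<i> * of_int s) *\<^sub>C w)) {k. sgn k = s}"
    if s: "s = 1 \<or> s = - 1" and w: "w = S (fst z) - (\<i> * of_int s) *\<^sub>C snd z" for s w
  proof -
    \<comment> \<open>the embedding carries the expansion of \<open>w\<close> termwise to the claimed one\<close>
    have bl: "bounded_linear (\<lambda>x. of_real (1 / 2) *\<^sub>C (x, (\<i> * of_int s) *\<^sub>C x))"
      by (intro bounded_linear_compose[OF bounded_linear_scaleC] bounded_linear_Pair
          bounded_linear_ident bounded_linear_scaleC)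
    have "((\<lambda>k. of_real (1 / 2) *\<^sub>C (cinner w (\<phi> k) *\<^sub>C \<phi> k, (\<i> * of_int s) *\<^sub>C cinner w (\<phi> k) *\<^sub>C \<phi> k)) has_sum
        of_real (1 / 2) *\<^sub>C (w, (\<i> * of_int s) *\<^sub>C w)) {1..}"
      using has_sum_bounded_linear[OF bl phi_expansion[of w]] by (simp add: o_def)
    also have "?this \<longleftrightarrow> ?thesis"
    proof (rule has_sum_reindex_bij_witness[where i = "\<lambda>k. nat \<bar>k\<bar>" and j = "\<lambda>k. s * int k"])
      fix k :: nat assume "k \<in> {1..}"
      then have k: "k \<ge> 1" by simp
      have sk: "sgn (s * int k) = s" "nat \<bar>s * int k\<bar> = k" "s * int k \<noteq> 0"
        using s k by (auto simp: sgn_mult abs_mult)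
      have q: "complex_of_real (sqrt 2) * complex_of_real (sqrt 2) = 2"
        by (simp add: of_real_mult[symmetric] del: of_real_mult)
      have ss: "complex_of_int s * complex_of_int s = 1" using s by auto
      let ?p = "cinner (S (fst z)) (\<phi> k)" and ?q = "cinner (snd z) (\<phi> k)"
      have cw: "cinner w (\<phi> k) = ?p - \<i> * of_int s * ?q"
        by (simp add: w cinner_diff_left cinner_scaleC_left)
      have "(\<i> * of_int s * ?p + ?q) / of_real (sqrt 2) * (- \<i> * of_int s / of_real (sqrt 2))
          = of_real (1 / 2) * cinner w (\<phi> k)"
        "(\<i> * of_int s * ?p + ?q) / of_real (sqrt 2) * of_real (1 / sqrt 2)
          = of_real (1 / 2) * (\<i> * of_int s * cinner w (\<phi> k))"
        using s by (auto simp: cw field_simps q)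
      then show "coeff z (s * int k) *\<^sub>C J (\<psi> (s * int k)) =
          of_real (1 / 2) *\<^sub>C (cinner w (\<phi> k) *\<^sub>C \<phi> k, (\<i> * of_int s) *\<^sub>C cinner w (\<phi> k) *\<^sub>C \<phi> k)"
        unfolding coeff_eq[OF sk(3)] J_psi[OF sk(3)] sk scaleC_prod_def fst_conv snd_conv scaleC_scaleC
        by (simp only:)
    qed (use s in \<open>auto simp: sgn_if split: if_splits\<close>)
    finally show ?thesis .
  qed
  have "((\<lambda>k. coeff z k *\<^sub>C J (\<psi> k)) has_sum
      of_real (1 / 2) *\<^sub>C (S (fst z) - (\<i> * of_int 1) *\<^sub>C snd z, (\<i> * of_int 1) *\<^sub>C (S (fst z) - (\<i> * of_int 1) *\<^sub>C snd z))
      + of_real (1 / 2) *\<^sub>C (S (fst z) - (\<i> * of_int (- 1)) *\<^sub>C snd z, (\<i> * of_int (- 1)) *\<^sub>C (S (fst z) - (\<i> * of_int (- 1)) *\<^sub>C snd z)))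
      ({k. sgn k = 1} \<union> {k. sgn k = - 1})"
    by (intro has_sum_Un_disjoint half) auto
  also have "{k. sgn k = 1} \<union> {k. sgn k = - 1} = - {0::int}"
    by (auto simp: sgn_if)
  also have "of_real (1 / 2) *\<^sub>C (S (fst z) - (\<i> * of_int 1) *\<^sub>C snd z, (\<i> * of_int 1) *\<^sub>C (S (fst z) - (\<i> * of_int 1) *\<^sub>C snd z))
      + of_real (1 / 2) *\<^sub>C (S (fst z) - (\<i> * of_int (- 1)) *\<^sub>C snd z, (\<i> * of_int (- 1)) *\<^sub>C (S (fst z) - (\<i> * of_int (- 1)) *\<^sub>C snd z)) = J z"
  proof -
    have half_sum: "of_real (1 / 2) *\<^sub>C x + of_real (1 / 2) *\<^sub>C y = a" if "x + y = 2 *\<^sub>R a" for x y a :: 'h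
      unfolding scaleC_of_real scaleR_add_right[symmetric] that by simp
    have "of_real (1 / 2) *\<^sub>C (S (fst z) - (\<i> * of_int 1) *\<^sub>C snd z) + of_real (1 / 2) *\<^sub>C (S (fst z) - (\<i> * of_int (- 1)) *\<^sub>C snd z) = S (fst z)"
      by (rule half_sum) (simp add: scaleC_minus_left scaleR_2)
    moreover have "of_real (1 / 2) *\<^sub>C (\<i> * of_int 1) *\<^sub>C (S (fst z) - (\<i> * of_int 1) *\<^sub>C snd z)
       + of_real (1 / 2) *\<^sub>C (\<i> * of_int (- 1)) *\<^sub>C (S (fst z) - (\<i> * of_int (- 1)) *\<^sub>C snd z) = snd z"
      by (rule half_sum) (simp add: scaleC_minus_left scaleC_diff_right scaleC_add_right scaleC_scaleC scaleR_2)
    ultimately show ?thesis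
      by (simp only: J_def scaleC_prod_def fst_conv snd_conv add_Pair)
  qed
  finally show ?thesis .
qed

lemma Parseval: "((\<lambda>k. (cmod (coeff z k))\<^sup>2) has_sum (X_norm S z)\<^sup>2) (- {0})"
proof -
  have "((\<lambda>F. (norm (\<Sum>k\<in>F. coeff z k *\<^sub>C J (\<psi> k)))\<^sup>2) \<longlongrightarrow> (norm (J z))\<^sup>2) (finite_subsets_at_top (- {0}))"
    using expansion[of z] unfolding has_sum_def by (intro tendsto_intros)
  moreover have "\<forall>\<^sub>F F in finite_subsets_at_top (- {0}).
      (norm (\<Sum>k\<in>F. coeff z k *\<^sub>C J (\<psi> k)))\<^sup>2 = (\<Sum>k\<in>F. (cmod (coeff z k))\<^sup>2)"
    by (intro eventually_finite_subsets_at_top_weakI norm_sum_orthonormal psi_orthonormal) auto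
  ultimately show ?thesis unfolding has_sum_def X_norm_J by (rule Lim_transform_eventually)
qed

text \<open>
  Summability follows from \<open>\<bar>\<mu>\<bar> \<le> 1 + \<mu>\<^sup>2\<close> and the Parseval identities of \<open>z\<close> and \<open>A z\<close>. Multiplied by
  the squared norm, the frequency function becomes a quadratic form, which adds up over wave packets.
\<close>

lemma freq_has_sum:
  assumes z: "z \<in> DA"
  shows "((\<lambda>k. lam (nat \<bar>k\<bar>) * (cmod (coeff z k))\<^sup>2) has_sum freq z * (X_norm S z)\<^sup>2) (- {0})"
proof -
  have "(\<lambda>k. lam (nat \<bar>k\<bar>) * (cmod (coeff z k))\<^sup>2) summable_on (- {0})"
  proof (rule summable_on_comparison_test)
    show "(\<lambda>k. (cmod (coeff z k))\<^sup>2 + (cmod (coeff (A z) k))\<^sup>2) summable_on (- {0})"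
      by (intro summable_on_add has_sum_imp_summable[OF Parseval])
    fix k :: int assume k: "k \<in> - {0}"
    then have l: "lam (nat \<bar>k\<bar>) = \<bar>\<mu> k\<bar>" by (simp add: eig_A_abs)
    have "\<bar>\<mu> k\<bar> \<le> 1 + (\<mu> k)\<^sup>2"
      using sum_squares_bound[of "\<bar>\<mu> k\<bar>" 1] by (simp add: power2_eq_square)
    then have "\<bar>\<mu> k\<bar> * (cmod (coeff z k))\<^sup>2 \<le> (1 + (\<mu> k)\<^sup>2) * (cmod (coeff z k))\<^sup>2"
      by (rule mult_right_mono) simp
    then show "lam (nat \<bar>k\<bar>) * (cmod (coeff z k))\<^sup>2 \<le> (cmod (coeff z k))\<^sup>2 + (cmod (coeff (A z) k))\<^sup>2"
      using coeff_A[OF z] k by (simp add: l norm_mult power_mult_distrib algebra_simps)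
    show "0 \<le> lam (nat \<bar>k\<bar>) * (cmod (coeff z k))\<^sup>2" by (simp add: l)
  qed
  then have s: "((\<lambda>k. lam (nat \<bar>k\<bar>) * (cmod (coeff z k))\<^sup>2) has_sum
      (\<Sum>\<^sub>\<infinity>k\<in>- {0}. lam (nat \<bar>k\<bar>) * (cmod (coeff z k))\<^sup>2)) (- {0})"
    by (rule has_sum_infsum)
  show ?thesis
  proof (cases "X_norm S z = 0")
    case True
    then have "z = 0" using X_norm_pos[of z] z by auto
    then have "J z = 0" using clinear_on_zero[OF J_clinear] by simp
    then show ?thesis by (simp add: True X_inner_J)
  next
    case False
    then show ?thesis using s by (simp add: freq_absA_def infsumI[OF Parseval])
  qed
qed

lemma lam_1_le: "k \<noteq> 0 \<Longrightarrow> lam 1 \<le> lam (nat \<bar>k\<bar>)"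
  by (intro lam_mono) auto

lemma freq_ge:
  assumes "z \<in> DA - {0}" shows "lam 1 \<le> freq z"
proof -
  have "lam 1 * (X_norm S z)\<^sup>2 \<le> freq z * (X_norm S z)\<^sup>2"
    by (rule has_sum_mono[OF has_sum_cmult_right[OF Parseval] freq_has_sum])
      (use assms lam_1_le in \<open>auto intro!: mult_right_mono\<close>)
  then show ?thesis using X_norm_pos[OF assms] by simp
qed

lemma freq_pos: "z \<in> DA - {0} \<Longrightarrow> 0 < freq z"
  using freq_ge[of z] lam_pos[of 1] by simp

text \<open>
  There is no eigenvector of index 0. Leaving this index out of the sum, rather than restricting \<open>F\<close>,
  frees the statements below from the side condition \<open>0 \<notin> F\<close>.
\<close>

definition comb :: "int set \<Rightarrow> (int \<Rightarrow> complex) \<Rightarrow> 'h \<times> 'h" where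
  "comb F a = (\<Sum>k\<in>F - {0}. a k *\<^sub>C \<psi> k)"

lemma comb_DA: "comb F a \<in> DA"
  unfolding comb_def by (intro csubspace_sum DA_csubspace psi_DA) simp

lemma J_comb: "J (comb F a) = (\<Sum>k\<in>F - {0}. a k *\<^sub>C J (\<psi> k))"
  unfolding comb_def by (intro clinear_on_sum[OF J_clinear_DA] psi_DA) simp

lemma C_comb: "C (comb F a) = (\<Sum>k\<in>F - {0}. a k *\<^sub>C C (\<psi> k))"
  unfolding comb_def by (intro clinear_on_sum[OF C_clinear] psi_DA) simp

lemma A_comb: "A (comb F a) = comb F (\<lambda>k. of_real (\<mu> k) * a k)"
proof -
  have "A (comb F a) = (\<Sum>k\<in>F - {0}. a k *\<^sub>C A (\<psi> k))"
    unfolding comb_def by (intro clinear_on_sum[OF A_clinear] psi_DA) simp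
  then show ?thesis
    by (simp add: comb_def A_psi scaleC_scaleC mult.commute)
qed

lemma X_norm_comb: "finite F \<Longrightarrow> (X_norm S (comb F a))\<^sup>2 = (\<Sum>k\<in>F - {0}. (cmod (a k))\<^sup>2)"
  unfolding X_norm_J J_comb by (intro norm_sum_orthonormal psi_orthonormal) auto

lemma coeff_comb:
  assumes "finite F" "k \<noteq> 0"
  shows "coeff (comb F a) k = (if k \<in> F then a k else 0)"
proof -
  have "coeff (comb F a) k = (\<Sum>j\<in>F - {0}. if j = k then a k else 0)"
    unfolding X_inner_J J_comb cinner_sum_left cinner_scaleC_left
    by (intro sum.cong refl) (use assms in \<open>auto simp: psi_orthonormal\<close>)
  then show ?thesis using assms by simp
qed

lemma freq_comb:
  assumes "finite F"
  shows "freq (comb F a) * (X_norm S (comb F a))\<^sup>2 = (\<Sum>k\<in>F - {0}. lam (nat \<bar>k\<bar>) * (cmod (a k))\<^sup>2)"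
proof (rule has_sum_unique[OF freq_has_sum[OF comb_DA]])
  show "((\<lambda>k. lam (nat \<bar>k\<bar>) * (cmod (coeff (comb F a) k))\<^sup>2) has_sum
    (\<Sum>k\<in>F - {0}. lam (nat \<bar>k\<bar>) * (cmod (a k))\<^sup>2)) (- {0})"
    by (rule has_sum_finite_neutralI[of "F - {0}"]) (use assms in \<open>auto simp: coeff_comb\<close>)
qed

text \<open>
  The frequency \<open>\<lambda>\<^sub>A(z)\<close> minimises \<open>\<tau> \<mapsto> \<parallel>(A - \<tau>) z\<parallel>\<^sup>2\<close>, and the minimum over
  \<open>\<parallel>z\<parallel>\<^sup>2\<close> is the variance.
\<close>

lemma variance_shift:
  assumes z: "z \<in> DA - {0}"
  shows "(X_norm S (A z))\<^sup>2 / (X_norm S z)\<^sup>2 - (freq_A A0 S z)\<^sup>2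
    = (norm (J (A z) - \<tau> *\<^sub>R J z))\<^sup>2 / (X_norm S z)\<^sup>2 - (\<tau> - freq_A A0 S z)\<^sup>2"
proof -
  have n: "X_norm S z > 0" by (rule X_norm_pos[OF z])
  have "(norm (J (A z) - \<tau> *\<^sub>R J z))\<^sup>2 = (X_norm S (A z))\<^sup>2 - 2 * (\<tau> * Re (X_inner S (A z) z)) + \<tau>\<^sup>2 * (X_norm S z)\<^sup>2"
    by (simp add: norm_diff_sq X_norm_J X_inner_J scaleR_scaleC cinner_scaleC_right norm_scaleC power_mult_distrib)
  moreover have "Re (X_inner S (A z) z) = freq_A A0 S z * (X_norm S z)\<^sup>2"
    using n by (simp add: freq_A_def)
  ultimately show ?thesis using n by (simp add: field_simps power2_eq_square)
qed

section \<open>The group on finite combinations of eigenvectors\<close>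

lemma U_clinear: "clinear_on X (U t)" and U_X: "z \<in> X \<Longrightarrow> U t z \<in> X"
  and U_isometry: "z \<in> X \<Longrightarrow> X_norm S (U t z) = X_norm S z"
  and U_0: "z \<in> X \<Longrightarrow> U 0 z = z"
  and U_add: "z \<in> X \<Longrightarrow> U (s + t) z = U s (U t z)"
  and U_generator: "z \<in> X \<Longrightarrow> w \<in> X \<Longrightarrow>
      ((\<lambda>t. X_norm S ((1 / t) *\<^sub>R (U t z - z) - w)) \<longlongrightarrow> 0) (at 0) \<longleftrightarrow> z \<in> DA \<and> w = \<i> *\<^sub>C A z"
  using U unfolding isometry_group_generated_by_def by simp_all

lemma X_scaleR: "z \<in> X \<Longrightarrow> r *\<^sub>R z \<in> X"
  using X_csubspace by (simp add: scaleR_scaleC csubspace_def)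

lemma DA_X: "z \<in> DA \<Longrightarrow> z \<in> X" using DA_subset_X by blast

lemma iA_X: "z \<in> DA \<Longrightarrow> \<i> *\<^sub>C A z \<in> X"
  using X_csubspace A_in_X unfolding csubspace_def by blast

text \<open>
  The difference quotient at \<open>U t z\<close> is the image under \<open>U t\<close> of the one at \<open>z\<close>, so both converge
  together by isometry. The generator has domain exactly \<open>D(A)\<close>, which identifies the limit.
\<close>

lemma U_DA: 
  assumes z: "z \<in> DA" 
  shows "U t z \<in> DA" and "A (U t z) = U t (A z)"
proof -
  let ?w = "\<i> *\<^sub>C A z"
  have zX: "z \<in> X" and wX: "?w \<in> X" using z DA_X iA_X by auto
  have "((\<lambda>h. X_norm S ((1 / h) *\<^sub>R (U h z - z) - ?w)) \<longlongrightarrow> 0) (at 0)"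
    using U_generator[OF zX wX] z by simp
  moreover have "X_norm S ((1 / h) *\<^sub>R (U h (U t z) - U t z) - U t ?w) = X_norm S ((1 / h) *\<^sub>R (U h z - z) - ?w)" for h
  proof -
    have d: "U h z - z \<in> X" using U_X zX X_csubspace by (simp add: csubspace_diff)
    then have "U t ((1 / h) *\<^sub>R (U h z - z) - ?w) = (1 / h) *\<^sub>R (U t (U h z) - U t z) - U t ?w"
      using U_clinear[of t] zX wX U_X X_scaleR by (simp add: clinear_on_diff clinear_on_scaleR)
    moreover have "U h (U t z) = U t (U h z)"
      using U_add[OF zX, of h t] U_add[OF zX, of t h] by (simp add: add.commute)
    ultimately show ?thesis
      using U_isometry[of "(1 / h) *\<^sub>R (U h z - z) - ?w" t] d wX X_scaleR X_csubspace by (simp add: csubspace_diff)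
  qed
  ultimately have "((\<lambda>h. X_norm S ((1 / h) *\<^sub>R (U h (U t z) - U t z) - U t ?w)) \<longlongrightarrow> 0) (at 0)" by simp
  then have g: "U t z \<in> DA \<and> U t ?w = \<i> *\<^sub>C A (U t z)"
    using U_generator[of "U t z" "U t ?w"] zX wX U_X by blast
  then show "U t z \<in> DA" by blast
  have "\<i> *\<^sub>C A (U t z) = \<i> *\<^sub>C U t (A z)"
    using g U_clinear[of t] A_in_X[OF z] by (simp add: clinear_on_def)
  then have "(- \<i>) *\<^sub>C \<i> *\<^sub>C A (U t z) = (- \<i>) *\<^sub>C \<i> *\<^sub>C U t (A z)" by simp
  then show "A (U t z) = U t (A z)" by (simp add: scaleC_scaleC)
qed

lemma orbit_has_derivative:
  assumes z: "z \<in> DA"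
  shows "((\<lambda>t. cinner (J (U t z)) w) has_vector_derivative \<i> * cinner (J (A (U t z))) w) (at t)"
proof -
  let ?z = "U t z" and ?w = "\<i> *\<^sub>C A (U t z)"
  have zD: "?z \<in> DA" using U_DA z by simp
  then have zX: "?z \<in> X" "?w \<in> X" "A ?z \<in> X" using DA_X iA_X A_in_X by auto
  have lim: "((\<lambda>h. X_norm S ((1 / h) *\<^sub>R (U h ?z - ?z) - ?w) * norm w) \<longlongrightarrow> 0 * norm w) (at 0)"
    using U_generator[OF zX(1,2)] zD by (intro tendsto_mult tendsto_const) simp
  have "((\<lambda>h. norm (cinner (J (U (t + h) z)) w - cinner (J ?z) w - h *\<^sub>R (\<i> * cinner (J (A ?z)) w)) / norm h) \<longlongrightarrow> 0) (at 0)"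
  proof (rule Lim_null_comparison[OF _ lim[simplified]])
    have "norm (cinner (J (U (t + h) z)) w - cinner (J ?z) w - h *\<^sub>R (\<i> * cinner (J (A ?z)) w)) / norm h
      \<le> X_norm S ((1 / h) *\<^sub>R (U h ?z - ?z) - ?w) * norm w" if "h \<noteq> 0" for h
    proof -
      have e: "U (t + h) z = U h ?z" using U_add[of z h t] DA_X[OF z] by (simp add: add.commute)
      have "J ((1 / h) *\<^sub>R (U h ?z - ?z) - ?w) = (1 / h) *\<^sub>R (J (U h ?z) - J ?z) - \<i> *\<^sub>C J (A ?z)"
        using J_clinear zX U_X X_scaleR X_csubspace
        by (simp add: clinear_on_diff clinear_on_scaleR csubspace_diff) (simp add: clinear_on_def)
      then have "h *\<^sub>R cinner (J ((1 / h) *\<^sub>R (U h ?z - ?z) - ?w)) w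
          = of_real h * (of_real (1 / h) * (cinner (J (U h ?z)) w - cinner (J ?z) w) - \<i> * cinner (J (A ?z)) w)"
        by (simp only: cinner_diff_left cinner_scaleC_left cinner_scaleR_left scaleR_conv_of_real)
      also have "\<dots> = cinner (J (U (t + h) z)) w - cinner (J ?z) w - h *\<^sub>R (\<i> * cinner (J (A ?z)) w)"
        using that by (simp add: e scaleR_conv_of_real right_diff_distrib)
      finally have eq: "h *\<^sub>R cinner (J ((1 / h) *\<^sub>R (U h ?z - ?z) - ?w)) w
          = cinner (J (U (t + h) z)) w - cinner (J ?z) w - h *\<^sub>R (\<i> * cinner (J (A ?z)) w)" .
      have "norm (cinner (J (U (t + h) z)) w - cinner (J ?z) w - h *\<^sub>R (\<i> * cinner (J (A ?z)) w)) / norm h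
        = cmod (cinner (J ((1 / h) *\<^sub>R (U h ?z - ?z) - ?w)) w)"
        unfolding eq[symmetric] norm_scaleR using that by simp
      then show ?thesis using cinner_Cauchy_Schwarz by (simp add: X_norm_J)
    qed
    then show "\<forall>\<^sub>F h in at 0. norm (norm (cinner (J (U (t + h) z)) w - cinner (J ?z) w - h *\<^sub>R (\<i> * cinner (J (A ?z)) w)) / norm h)
      \<le> X_norm S ((1 / h) *\<^sub>R (U h ?z - ?z) - ?w) * norm w"
      by (auto simp: eventually_at_filter)
  qed
  then show ?thesis
    unfolding has_vector_derivative_def has_derivative_at by (simp add: bounded_linear_scaleR_left)
qed

text \<open>
  Each scalar function \<open>\<langle>U t \<psi>\<^sub>k, w\<rangle>\<close> solves \<open>s' = \<i> \<mu>\<^sub>k s\<close>.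
\<close>

lemma U_psi:
  assumes k: "k \<noteq> 0"
  shows "U t (\<psi> k) = cis (\<mu> k * t) *\<^sub>C \<psi> k"
proof -
  have D: "\<psi> k \<in> DA" and PX: "\<psi> k \<in> X" using psi_DA[OF k] DA_X by auto
  have "cinner (J (U t (\<psi> k))) w = cinner (cis (\<mu> k * t) *\<^sub>C J (\<psi> k)) w" for w
  proof -
    define s where "s = (\<lambda>t. cinner (J (U t (\<psi> k))) w)"
    have J_A: "J (A (U t (\<psi> k))) = of_real (\<mu> k) *\<^sub>C J (U t (\<psi> k))" for t
      using U_clinear[of t] PX J_clinear U_X[OF PX] by (simp add: U_DA[OF D] A_psi[OF k] clinear_on_def)
    have s': "(s has_vector_derivative \<i> * (of_real (\<mu> k) * s t)) (at t)" for t
      using orbit_has_derivative[OF D, of w t] unfolding s_def J_A by (simp add: cinner_scaleC_left)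
    have deriv: "((\<lambda>t. cis (- \<mu> k * t) * s t) has_vector_derivative 0) (at t within UNIV)" for t
    proof -
      have "cis (- \<mu> k * t) * (\<i> * (of_real (\<mu> k) * s t)) + \<i> * of_real (- \<mu> k) * cis (- \<mu> k * t) * s t = 0"
        unfolding of_real_minus by (simp only: mult_minus_left mult_minus_right mult_ac) simp
      then show ?thesis
        using has_vector_derivative_mult[OF cis_has_vector_derivative[of "- \<mu> k" t UNIV] s'[of t]]
        by (simp only:)
    qed
    obtain c where "\<And>t. t \<in> UNIV \<Longrightarrow> cis (- \<mu> k * t) * s t = c"
      by (rule has_vector_derivative_zero_constant[OF convex_UNIV deriv]) blast
    then have c: "cis (- \<mu> k * t) * s t = c" for t by blast
    have "s t = cis (\<mu> k * t) * (cis (- \<mu> k * t) * s t)"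
      by (simp only: mult.assoc[symmetric] cis_mult) simp
    also have "cis (- \<mu> k * t) * s t = cis (- \<mu> k * 0) * s 0" by (simp only: c)
    also have "\<dots> = s 0" by simp
    finally have "s t = cis (\<mu> k * t) * s 0" .
    then show ?thesis by (simp add: s_def U_0[OF PX] cinner_scaleC_left)
  qed
  then have "J (U t (\<psi> k)) = cis (\<mu> k * t) *\<^sub>C J (\<psi> k)" by (rule cinner_ext)
  also have "\<dots> = J (cis (\<mu> k * t) *\<^sub>C \<psi> k)" using J_clinear PX by (simp add: clinear_on_def)
  finally have "J (U t (\<psi> k) - cis (\<mu> k * t) *\<^sub>C \<psi> k) = 0"
    using J_clinear PX U_X X_csubspace by (simp add: clinear_on_diff csubspace_def)
  then show ?thesis
    using J_eq_0[of "U t (\<psi> k) - cis (\<mu> k * t) *\<^sub>C \<psi> k"] U_X[OF PX] PX X_csubspace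
    by (simp add: csubspace_diff csubspace_def)
qed

lemma U_comb: "U t (comb F a) = comb F (\<lambda>k. cis (\<mu> k * t) * a k)"
proof -
  have "U t (comb F a) = (\<Sum>k\<in>F - {0}. a k *\<^sub>C U t (\<psi> k))"
    unfolding comb_def by (intro clinear_on_sum[OF U_clinear] DA_X psi_DA) simp
  then show ?thesis by (simp add: comb_def U_psi scaleC_scaleC mult.commute)
qed

abbreviation trunc where "trunc z F \<equiv> comb F (coeff z)"

abbreviation finsets where "finsets \<equiv> finite_subsets_at_top (- {0::int})"

lemma eventually_finsets: "(\<And>F. finite F \<Longrightarrow> F - {0} = F \<Longrightarrow> P F) \<Longrightarrow> \<forall>\<^sub>F F in finsets. P F"
  by (rule eventually_finite_subsets_at_top_weakI) auto

lemma J_trunc: "((\<lambda>F. J (trunc z F)) \<longlongrightarrow> J z) finsets"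
  using expansion[of z] unfolding has_sum_def
  by (rule Lim_transform_eventually) (rule eventually_finsets, simp add: J_comb)

lemma JA_trunc: 
  assumes z: "z \<in> DA"
  shows "((\<lambda>F. J (A (trunc z F))) \<longlongrightarrow> J (A z)) finsets"
proof -
  have "trunc (A z) F = A (trunc z F)" for F
    unfolding A_comb by (simp add: comb_def coeff_A[OF z])
  then show ?thesis using J_trunc[of "A z"] by simp
qed

lemma X_norm_trunc: "((\<lambda>F. X_norm S (trunc z F)) \<longlongrightarrow> X_norm S z) finsets"
  unfolding X_norm_J by (intro tendsto_norm J_trunc)

lemma A_diff_trunc:
  assumes z: "z \<in> DA"
  shows "((\<lambda>F. X_norm S (A (trunc z F - z))) \<longlongrightarrow> 0) finsets"
proof -
  have "J (A (trunc z F - z)) = J (A (trunc z F)) - J (A z)" for F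
    using z by (simp add: clinear_on_diff[OF A_clinear] clinear_on_diff[OF J_clinear] comb_DA A_in_X)
  then show ?thesis
    using JA_trunc[OF z] by (simp add: X_norm_J LIM_zero tendsto_norm_zero)
qed

text \<open>
  On \<open>D(A)\<close> the output is bounded by a multiple of \<open>\<parallel>A z\<parallel>\<close>, which is constant along orbits.
\<close>

lemma C_trunc_uniform:
  assumes z: "z \<in> DA"
  shows "uniform_limit UNIV (\<lambda>F t. C (U t (trunc z F))) (\<lambda>t. C (U t z)) finsets"
proof -
  obtain M where M: "M \<ge> 0" "\<And>z. z \<in> DA \<Longrightarrow> norm (C z) \<le> M * X_norm S (A z)"
    using C_bounded by blast
  have lim: "((\<lambda>F. M * X_norm S (A (trunc z F - z))) \<longlongrightarrow> M * 0) finsets"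
    by (intro tendsto_mult tendsto_const A_diff_trunc z)
  have bound: "norm (C (U t (trunc z F)) - C (U t z)) \<le> M * X_norm S (A (trunc z F - z))" for t F
  proof -
    have d: "trunc z F - z \<in> DA" using comb_DA z DA_csubspace by (simp add: csubspace_diff)
    have "C (U t (trunc z F)) - C (U t z) = C (U t (trunc z F - z))"
      using z comb_DA by (simp add: clinear_on_diff[OF U_clinear] DA_X clinear_on_diff[OF C_clinear] U_DA)
    also have "norm \<dots> \<le> M * X_norm S (A (U t (trunc z F - z)))"
      by (intro M U_DA d)
    also have "\<dots> = M * X_norm S (A (trunc z F - z))"
      using d by (simp add: U_DA U_isometry A_in_X)
    finally show ?thesis .
  qed
  show ?thesis
    unfolding uniform_limit_iff dist_norm
  proof (intro allI impI)
    fix e :: real assume "e > 0"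
    then have "\<forall>\<^sub>F F in finsets. M * X_norm S (A (trunc z F - z)) < e"
      using order_tendstoD(2)[OF lim] by simp
    then show "\<forall>\<^sub>F F in finsets. \<forall>t\<in>UNIV. norm (C (U t (trunc z F)) - C (U t z)) < e"
      by eventually_elim (use bound in \<open>auto intro: le_less_trans\<close>)
  qed
qed

lemma continuous_CU_comb: "continuous_on B (\<lambda>t. C (U t (comb F a)))"
  unfolding U_comb C_comb by (intro continuous_intros)

lemma continuous_CU: "z \<in> DA \<Longrightarrow> continuous_on UNIV (\<lambda>t. C (U t z))"
  by (rule uniform_limit_theorem[OF _ C_trunc_uniform]) (auto intro: continuous_CU_comb)

lemma energy_integrable: "z \<in> DA \<Longrightarrow> (\<lambda>t. (norm (C (U t z)))\<^sup>2) integrable_on {a..b}"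
  by (intro integrable_continuous_real continuous_intros continuous_on_subset[OF continuous_CU]) auto

lemma energy_trunc:
  assumes z: "z \<in> DA"
  shows "((\<lambda>F. energy T (trunc z F)) \<longlongrightarrow> energy T z) finsets"
proof -
  have ul: "uniform_limit {0..T} (\<lambda>F t. C (U t (trunc z F))) (\<lambda>t. C (U t z)) finsets"
    by (rule uniform_limit_on_subset[OF C_trunc_uniform[OF z]]) simp
  have "bounded ((\<lambda>t. C (U t z)) ` {0..T})"
    by (intro compact_imp_bounded compact_continuous_image continuous_on_subset[OF continuous_CU[OF z]]) auto
  from bounded_bilinear.bounded_uniform_limit[OF bounded_bilinear_inner ul ul this this]
  have "uniform_limit {0..T} (\<lambda>F t. (norm (C (U t (trunc z F))))\<^sup>2) (\<lambda>t. (norm (C (U t z)))\<^sup>2) finsets"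
    by (simp add: power2_norm_eq_inner)
  then obtain I K where I: "\<And>F. ((\<lambda>t. (norm (C (U t (trunc z F))))\<^sup>2) has_integral I F) {0..T}"
    and K: "((\<lambda>t. (norm (C (U t z)))\<^sup>2) has_integral K) {0..T}" and IK: "(I \<longlongrightarrow> K) finsets"
    by (rule uniform_limit_integral) (auto intro!: continuous_intros continuous_CU_comb)
  then show ?thesis
    unfolding observed_energy_def by (simp add: integral_unique[OF I] integral_unique[OF K])
qed

lemma C_trunc: "z \<in> DA \<Longrightarrow> ((\<lambda>F. C (trunc z F)) \<longlongrightarrow> C z) finsets"
  using tendsto_uniform_limitI[OF C_trunc_uniform[of z], of 0] by (simp add: U_0 DA_X comb_DA)

lemma freq_trunc:
  assumes z: "z \<in> DA - {0}"
  shows "((\<lambda>F. freq (trunc z F)) \<longlongrightarrow> freq z) finsets"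
proof -
  have pos: "X_norm S z > 0" by (rule X_norm_pos[OF z])
  have "((\<lambda>F. freq (trunc z F) * (X_norm S (trunc z F))\<^sup>2) \<longlongrightarrow> freq z * (X_norm S z)\<^sup>2) finsets"
  proof (rule Lim_transform_eventually)
    show "(sum (\<lambda>k. lam (nat \<bar>k\<bar>) * (cmod (coeff z k))\<^sup>2) \<longlongrightarrow> freq z * (X_norm S z)\<^sup>2) finsets"
      using freq_has_sum[of z] z by (simp add: has_sum_def)
    show "\<forall>\<^sub>F F in finsets. (\<Sum>k\<in>F. lam (nat \<bar>k\<bar>) * (cmod (coeff z k))\<^sup>2) = freq (trunc z F) * (X_norm S (trunc z F))\<^sup>2"
      by (intro eventually_finsets) (simp add: freq_comb)
  qed
  then have "((\<lambda>F. freq (trunc z F) * (X_norm S (trunc z F))\<^sup>2 / (X_norm S (trunc z F))\<^sup>2)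
      \<longlongrightarrow> freq z * (X_norm S z)\<^sup>2 / (X_norm S z)\<^sup>2) finsets"
    by (rule tendsto_divide[OF _ tendsto_power[OF X_norm_trunc]]) (use pos in simp)
  then have "((\<lambda>F. freq (trunc z F) * (X_norm S (trunc z F))\<^sup>2 / (X_norm S (trunc z F))\<^sup>2) \<longlongrightarrow> freq z) finsets"
    using pos by simp
  moreover have "\<forall>\<^sub>F F in finsets. X_norm S (trunc z F) > 0"
    using order_tendstoD(1)[OF X_norm_trunc pos] .
  then have "\<forall>\<^sub>F F in finsets. freq (trunc z F) * (X_norm S (trunc z F))\<^sup>2 / (X_norm S (trunc z F))\<^sup>2 = freq (trunc z F)"
    by eventually_elim simp
  ultimately show ?thesis by (rule Lim_transform_eventually)
qed

section \<open>From weak observability to spectral coercivity\<close>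

lemma energy_nonneg: "z \<in> DA \<Longrightarrow> 0 \<le> energy T z"
  unfolding observed_energy_def by (intro integral_nonneg energy_integrable) auto

lemma energy_mono:
  assumes "z \<in> DA" "T \<le> T'"
  shows "energy T z \<le> energy T' z"
  unfolding observed_energy_def
  by (rule integral_subset_le) (use assms in \<open>auto simp: energy_integrable\<close>)

text \<open>
  Split \<open>[0, T]\<close> into unit intervals and use that the group is isometric. Admissibility alone gives
  some constant for each \<open>T\<close>; the bound must be continuous and monotone in \<open>T\<close> to enter a function
  of class \<open>Sigma_d\<close>.
\<close>

lemma energy_linear_growth: "\<exists>K>0. \<forall>T\<ge>0. \<forall>z\<in>DA. energy T z \<le> K * (T + 1) * (X_norm S z)\<^sup>2"
proof -
  obtain K where K: "K > 0" "\<And>z. z \<in> DA \<Longrightarrow> energy 1 z \<le> K * (X_norm S z)\<^sup>2"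
    using adm unfolding admissible_def by (meson zero_less_one)
  have step: "energy (real n) z \<le> real n * (K * (X_norm S z)\<^sup>2)" if z: "z \<in> DA" for n z
  proof (induction n)
    case 0
    show ?case by (simp add: observed_energy_def)
  next
    case (Suc n)
    let ?f = "\<lambda>t. (norm (C (U t z)))\<^sup>2"
    have "energy (real (Suc n)) z = energy (real n) z + integral {real n..real (Suc n)} ?f"
      unfolding observed_energy_def
      by (rule Henstock_Kurzweil_Integration.integral_combine[symmetric]) (auto intro: energy_integrable z)
    also have "integral {real n..real (Suc n)} ?f = integral {0..1} (?f \<circ> (\<lambda>t. t + real n))"
      using integral_shift[of 0 "real n" 1 ?f] z
      by (simp add: add.commute continuous_on_subset[OF continuous_CU] continuous_intros)
    also have "\<dots> = energy 1 (U (real n) z)"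
      by (simp add: observed_energy_def o_def U_add DA_X z)
    also have "\<dots> \<le> K * (X_norm S z)\<^sup>2"
      using K(2)[OF U_DA(1)[OF z]] by (simp add: U_isometry DA_X z)
    finally show ?case using Suc.IH by (simp add: algebra_simps)
  qed
  have "energy T z \<le> K * (T + 1) * (X_norm S z)\<^sup>2" if "T \<ge> 0" "z \<in> DA" for T z
  proof -
    have n: "T \<le> real (nat \<lceil>T\<rceil>)" "real (nat \<lceil>T\<rceil>) \<le> T + 1" using that(1) by linarith+
    have "energy T z \<le> energy (real (nat \<lceil>T\<rceil>)) z" by (rule energy_mono[OF that(2) n(1)])
    also have "\<dots> \<le> real (nat \<lceil>T\<rceil>) * (K * (X_norm S z)\<^sup>2)" by (rule step[OF that(2)])
    also have "\<dots> \<le> (T + 1) * (K * (X_norm S z)\<^sup>2)"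
      by (rule mult_right_mono[OF n(2)]) (use K(1) in simp)
    finally show ?thesis by (simp add: mult_ac)
  qed
  then show ?thesis using K(1) by blast
qed

text \<open>
  With \<open>f = (A - \<tau>) z\<close>, the function \<open>h t = cis (- \<tau> t) C (U t z) - C z\<close> vanishes at 0 and has a
  derivative of norm \<open>\<parallel>C (U t f)\<parallel>\<close>.
\<close>

lemma Duhamel_comb:
  assumes T: "T \<ge> 0" and f: "f = comb F (\<lambda>k. of_real (\<mu> k - \<tau>) * a k)"
  shows "energy T (comb F a) \<le> 2 * T * (norm (C (comb F a)))\<^sup>2 + 2 * T\<^sup>2 * energy T f"
proof -
  let ?z = "comb F a"
  define h where "h t = (\<Sum>k\<in>F - {0}. ((cis ((\<mu> k - \<tau>) * t) - 1) * a k) *\<^sub>C C (\<psi> k))" for t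
  define h' where "h' t = (\<Sum>k\<in>F - {0}. (\<i> * of_real (\<mu> k - \<tau>) * cis ((\<mu> k - \<tau>) * t) * a k) *\<^sub>C C (\<psi> k))" for t
  have shift: "cis ((\<mu> k - \<tau>) * t) = cis (- (\<tau> * t)) * cis (\<mu> k * t)" for k t
    by (simp add: cis_mult algebra_simps)
  have "h' t = (\<i> * cis (- (\<tau> * t))) *\<^sub>C C (U t f)" for t
    unfolding f U_comb C_comb h'_def shift by (simp add: scaleC_sum_right scaleC_scaleC mult_ac)
  then have h'_norm: "norm (h' t) = norm (C (U t f))" for t
    by (simp add: norm_scaleC norm_mult)
  have h'_cont: "continuous_on B h'" for B unfolding h'_def by (intro continuous_intros)
  have deriv: "(h has_vector_derivative h' t) (at t within B)" for t B
    unfolding h_def h'_def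
  proof (intro has_vector_derivative_sum bounded_linear.has_vector_derivative[OF bounded_linear_scaleC_left])
    fix k
    show "((\<lambda>t. (cis ((\<mu> k - \<tau>) * t) - 1) * a k) has_vector_derivative
        \<i> * of_real (\<mu> k - \<tau>) * cis ((\<mu> k - \<tau>) * t) * a k) (at t within B)"
    proof -
      have "((\<lambda>t. cis ((\<mu> k - \<tau>) * t) - 1) has_vector_derivative
          \<i> * of_real (\<mu> k - \<tau>) * cis ((\<mu> k - \<tau>) * t) - 0) (at t within B)"
        by (intro has_vector_derivative_diff cis_has_vector_derivative has_vector_derivative_const)
      from has_vector_derivative_mult_left[OF this, of "a k"] show ?thesis by simp
    qed
  qed
  have h_bound: "(norm (h t))\<^sup>2 \<le> T * energy T f" if t: "t \<in> {0..T}" for t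
  proof -
    have "(h' has_integral h t - h 0) {0..t}"
      by (rule fundamental_theorem_of_calculus) (use t deriv in auto)
    then have "h t = integral {0..t} h'" by (simp add: h_def integral_unique)
    then have "norm (h t) \<le> integral {0..t} (\<lambda>s. norm (C (U s f)))"
      using h'_norm by (auto intro!: integral_norm_bound_integral integrable_continuous_real h'_cont
          continuous_intros continuous_CU_comb simp: f)
    then have "(norm (h t))\<^sup>2 \<le> (integral {0..t} (\<lambda>s. norm (C (U s f))))\<^sup>2"
      by (rule power_mono) simp
    also have "\<dots> \<le> t * energy t f"
      unfolding observed_energy_def
      by (rule integral_sq_le) (use t in \<open>auto simp: f intro!: continuous_intros continuous_CU_comb\<close>)
    also have "\<dots> \<le> T * energy T f"
      using t T by (intro mult_mono energy_mono energy_nonneg) (auto simp: f comb_DA)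
    finally show ?thesis .
  qed
  have pointwise: "(norm (C (U t ?z)))\<^sup>2 \<le> 2 * (norm (C ?z))\<^sup>2 + 2 * (T * energy T f)" if t: "t \<in> {0..T}" for t
  proof -
    have "h t + C ?z = (\<Sum>k\<in>F - {0}. (cis ((\<mu> k - \<tau>) * t) * a k) *\<^sub>C C (\<psi> k))"
      unfolding h_def C_comb by (simp add: sum.distrib[symmetric] scaleC_add_left[symmetric] left_diff_distrib)
    also have "\<dots> = cis (- (\<tau> * t)) *\<^sub>C C (U t ?z)"
      unfolding U_comb C_comb shift by (simp add: scaleC_sum_right scaleC_scaleC mult_ac)
    finally have "norm (C (U t ?z)) = norm (h t + C ?z)" by (simp add: norm_scaleC)
    also have "\<dots> \<le> norm (h t) + norm (C ?z)" by (rule norm_triangle_ineq)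
    finally have "(norm (C (U t ?z)))\<^sup>2 \<le> (norm (h t) + norm (C ?z))\<^sup>2" by (rule power_mono) simp
    also have "\<dots> \<le> 2 * (norm (h t))\<^sup>2 + 2 * (norm (C ?z))\<^sup>2"
      using sum_squares_bound[of "norm (h t)" "norm (C ?z)"] by (simp add: power2_sum)
    finally show ?thesis using h_bound[OF t] by simp
  qed
  have "energy T ?z \<le> integral {0..T} (\<lambda>t. 2 * (norm (C ?z))\<^sup>2 + 2 * (T * energy T f))"
    unfolding observed_energy_def[of _ _ _ ?z]
    by (intro integral_le pointwise energy_integrable comb_DA) auto
  also have "\<dots> = 2 * T * (norm (C ?z))\<^sup>2 + 2 * T\<^sup>2 * energy T f"
    using T by (simp add: algebra_simps power2_eq_square)
  finally show ?thesis .
qed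

lemma J_A_minus: "J (A (comb F a)) - \<tau> *\<^sub>R J (comb F a) = J (comb F (\<lambda>k. of_real (\<mu> k - \<tau>) * a k))"
  unfolding A_comb J_comb
  by (simp add: scaleR_scaleC scaleC_sum_right scaleC_scaleC sum_subtractf[symmetric] scaleC_diff_left[symmetric] left_diff_distrib)

text \<open>
  For general \<open>z\<close> in \<open>D(A)\<close> the vector \<open>(A - \<tau>) z\<close> need not lie in \<open>D(A)\<close> and has no pointwise
  output. Admissibility removes its output from the right-hand side, and what remains passes to the
  limit of truncations.
\<close>

lemma Duhamel_inequality:
  assumes T: "T \<ge> 0" and K: "\<And>z. z \<in> DA \<Longrightarrow> energy T z \<le> K * (X_norm S z)\<^sup>2" and z: "z \<in> DA"
  shows "energy T z \<le> 2 * T * (norm (C z))\<^sup>2 + 2 * T\<^sup>2 * (K * (norm (J (A z) - \<tau> *\<^sub>R J z))\<^sup>2)"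
proof (rule tendsto_le[OF finite_subsets_at_top_neq_bot])
  show "((\<lambda>F. energy T (trunc z F)) \<longlongrightarrow> energy T z) finsets" by (rule energy_trunc[OF z])
  show "((\<lambda>F. 2 * T * (norm (C (trunc z F)))\<^sup>2 + 2 * T\<^sup>2 * (K * (norm (J (A (trunc z F)) - \<tau> *\<^sub>R J (trunc z F)))\<^sup>2))
      \<longlongrightarrow> 2 * T * (norm (C z))\<^sup>2 + 2 * T\<^sup>2 * (K * (norm (J (A z) - \<tau> *\<^sub>R J z))\<^sup>2)) finsets"
    by (intro tendsto_intros C_trunc JA_trunc J_trunc z)
  show "\<forall>\<^sub>F F in finsets. energy T (trunc z F)
      \<le> 2 * T * (norm (C (trunc z F)))\<^sup>2 + 2 * T\<^sup>2 * (K * (norm (J (A (trunc z F)) - \<tau> *\<^sub>R J (trunc z F)))\<^sup>2)"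
  proof (intro always_eventually allI)
    fix F
    have "energy T (comb F (\<lambda>k. of_real (\<mu> k - \<tau>) * coeff z k)) \<le> K * (norm (J (A (trunc z F)) - \<tau> *\<^sub>R J (trunc z F)))\<^sup>2"
      unfolding J_A_minus X_norm_J[symmetric] by (intro K comb_DA)
    then have "2 * T\<^sup>2 * energy T (comb F (\<lambda>k. of_real (\<mu> k - \<tau>) * coeff z k))
        \<le> 2 * T\<^sup>2 * (K * (norm (J (A (trunc z F)) - \<tau> *\<^sub>R J (trunc z F)))\<^sup>2)"
      by (intro mult_left_mono) auto
    then show "energy T (trunc z F)
      \<le> 2 * T * (norm (C (trunc z F)))\<^sup>2 + 2 * T\<^sup>2 * (K * (norm (J (A (trunc z F)) - \<tau> *\<^sub>R J (trunc z F)))\<^sup>2)"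
      using Duhamel_comb[OF T refl, of F "coeff z" \<tau>] by linarith
  qed
qed

text \<open>
  With observation time \<open>T\<close> and weight \<open>\<Psi>\<close>, a variance of at most \<open>\<Psi> / (4 T\<^sup>2 K (T + 1))\<close> makes the
  last term of Duhamel's inequality at most half of the observed lower bound.
\<close>

lemma spectrally_coercive_if_weakly_observable:
  assumes "weakly_observable D0 D1 S lam \<phi> C0 U"
  shows "spectrally_coercive D0 A0 D1 S lam \<phi> C0"
proof -
  obtain \<T> \<Psi> where \<T>: "\<T> \<in> Sigma_i" and \<Psi>: "\<Psi> \<in> Sigma_d"
    and obs: "\<And>z. z \<in> DA - {0} \<Longrightarrow> \<Psi> (freq z) * (X_norm S z)\<^sup>2 \<le> energy (\<T> (freq z)) z"
    using assms by (auto simp: weakly_observable_def)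
  obtain K where K: "K > 0" "\<And>T z. T \<ge> 0 \<Longrightarrow> z \<in> DA \<Longrightarrow> energy T z \<le> K * (T + 1) * (X_norm S z)\<^sup>2"
    using energy_linear_growth by blast
  note Tpos = Sigma_i_pos[OF \<T>]
  have "4 * (\<T> x)\<^sup>2 * (K * (\<T> x + 1)) \<le> 4 * (\<T> y)\<^sup>2 * (K * (\<T> y + 1))" if "0 \<le> x" "x \<le> y" for x y
    using Sigma_i_mono[OF \<T> that] Tpos[of x] K(1)
    by (intro mult_mono power_mono mult_left_mono add_right_mono) auto
  then have "(\<lambda>l. 4 * (\<T> l)\<^sup>2 * (K * (\<T> l + 1))) \<in> Sigma_i" "(\<lambda>l. 4 * \<T> l) \<in> Sigma_i"
    using \<T> K(1) Tpos unfolding Sigma_i_def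
    by (auto simp: monotone_on_def add_pos_pos less_imp_neq[THEN not_sym] intro!: continuous_intros)
  note in_Sigma_d = this[THEN Sigma_d_divide[OF \<Psi>]]
  have "\<Psi> (freq z) / (4 * \<T> (freq z)) * (X_norm S z)\<^sup>2 \<le> (norm (C z))\<^sup>2"
    if z: "z \<in> DA - {0}" and var: "(X_norm S (A z))\<^sup>2 / (X_norm S z)\<^sup>2 - (freq_A A0 S z)\<^sup>2
        \<le> \<Psi> (freq z) / (4 * (\<T> (freq z))\<^sup>2 * (K * (\<T> (freq z) + 1)))" for z
  proof -
    define T where "T = \<T> (freq z)"
    \<comment> \<open>the choice of \<open>\<tau>\<close> for which the defect equals the variance\<close>
    define \<tau> where "\<tau> = freq_A A0 S z"
    define d where "d = (norm (J (A z) - \<tau> *\<^sub>R J z))\<^sup>2"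
    define N where "N = (X_norm S z)\<^sup>2"
    define Q where "Q = K * (T + 1)"
    have T: "T > 0" by (simp add: T_def Tpos)
    have N: "N > 0" using X_norm_pos[OF z] by (simp add: N_def)
    have Q: "Q > 0" using K(1) T by (simp add: Q_def)
    have "d / N \<le> \<Psi> (freq z) / (4 * T\<^sup>2 * Q)"
      using var variance_shift[OF z, of \<tau>] by (simp add: d_def N_def T_def Q_def \<tau>_def)
    then have d: "2 * T\<^sup>2 * (Q * d) \<le> \<Psi> (freq z) * N / 2"
      using N T Q by (simp add: field_simps)
    have "\<Psi> (freq z) * N \<le> energy T z" using obs[OF z] by (simp add: N_def T_def)
    also have "\<dots> \<le> 2 * T * (norm (C z))\<^sup>2 + 2 * T\<^sup>2 * (Q * d)"
      unfolding d_def Q_def using T z K(2) by (intro Duhamel_inequality) auto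
    finally have "\<Psi> (freq z) * N / 2 \<le> 2 * T * (norm (C z))\<^sup>2" using d by linarith
    then show ?thesis using T by (simp add: T_def[symmetric] N_def[symmetric] field_simps)
  qed
  then show ?thesis
    unfolding spectrally_coercive_def spectrally_coercive_with_def
    by (intro bexI[OF _ in_Sigma_d(1)] bexI[OF _ in_Sigma_d(2)]) auto
qed

section \<open>From spectral coercivity to weak observability\<close>

text \<open>
  Chebyshev's inequality in additive form: if the defect of \<open>w\<close> relative to \<open>\<tau>\<close> or its frequency is
  too large for coercivity to apply, the left-hand side is nonpositive. The bound can therefore be
  summed over all packets without selecting the good ones.
\<close>

lemma coercive_packet_bound:
  assumes coer: "spectrally_coercive_with D0 A0 D1 S lam \<phi> C0 \<epsilon> \<Psi>"
    and \<epsilon>: "\<epsilon> \<in> Sigma_d" and \<Psi>: "\<Psi> \<in> Sigma_d" and l: "l > 0" and v: "v > 0" "v \<le> \<epsilon> l"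
    and w: "w \<in> DA"
  shows "\<Psi> l * ((X_norm S w)\<^sup>2 - (norm (J (A w) - \<tau> *\<^sub>R J w))\<^sup>2 / v - freq w * (X_norm S w)\<^sup>2 / l) \<le> (norm (C w))\<^sup>2"
proof -
  let ?b = "(X_norm S w)\<^sup>2 - (norm (J (A w) - \<tau> *\<^sub>R J w))\<^sup>2 / v - freq w * (X_norm S w)\<^sup>2 / l"
  consider "w = 0" | "w \<noteq> 0" "freq w > l" | "w \<noteq> 0" "(norm (J (A w) - \<tau> *\<^sub>R J w))\<^sup>2 > v * (X_norm S w)\<^sup>2"
    | "w \<noteq> 0" "freq w \<le> l" "(norm (J (A w) - \<tau> *\<^sub>R J w))\<^sup>2 \<le> v * (X_norm S w)\<^sup>2"
    by linarith
  then show ?thesis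
  proof cases
    case 1
    then have "X_norm S w = 0" using clinear_on_zero[OF J_clinear] by (simp add: X_norm_J)
    then have "?b \<le> 0" using v by simp
    then have "\<Psi> l * ?b \<le> 0" using Sigma_d_pos[OF \<Psi>, of l] by (simp add: mult_le_0_iff)
    then show ?thesis by (rule order_trans) simp
  next
    case 2
    then have "(X_norm S w)\<^sup>2 \<le> freq w * (X_norm S w)\<^sup>2 / l"
      using l by (simp add: field_simps mult_right_mono)
    then have "?b \<le> 0" using v by (smt (verit) zero_le_divide_iff zero_le_power2)
    then have "\<Psi> l * ?b \<le> 0" using Sigma_d_pos[OF \<Psi>, of l] by (simp add: mult_le_0_iff)
    then show ?thesis by (rule order_trans) simp
  next
    case 3
    then have "(X_norm S w)\<^sup>2 \<le> (norm (J (A w) - \<tau> *\<^sub>R J w))\<^sup>2 / v"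
      using v by (simp add: field_simps)
    moreover have "0 \<le> freq w * (X_norm S w)\<^sup>2 / l" using freq_pos[of w] 3 w l by simp
    ultimately have "?b \<le> 0" by linarith
    then have "\<Psi> l * ?b \<le> 0" using Sigma_d_pos[OF \<Psi>, of l] by (simp add: mult_le_0_iff)
    then show ?thesis by (rule order_trans) simp
  next
    case 4
    then have z: "w \<in> DA - {0}" using w by simp
    have N: "X_norm S w > 0" by (rule X_norm_pos[OF z])
    have "(X_norm S (A w))\<^sup>2 / (X_norm S w)\<^sup>2 - (freq_A A0 S w)\<^sup>2 \<le> (norm (J (A w) - \<tau> *\<^sub>R J w))\<^sup>2 / (X_norm S w)\<^sup>2"
      unfolding variance_shift[OF z, of \<tau>] by simp
    also have "\<dots> \<le> v" using 4 N by (simp add: field_simps)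
    also have "\<dots> \<le> \<epsilon> (freq w)"
      using v(2) Sigma_d_antimono[OF \<epsilon> _ 4(2)] freq_pos[OF z] by simp
    finally have "\<Psi> (freq w) * (X_norm S w)\<^sup>2 \<le> (norm (C w))\<^sup>2"
      using coer z unfolding spectrally_coercive_with_def by blast
    moreover have "\<Psi> l * ?b \<le> \<Psi> (freq w) * (X_norm S w)\<^sup>2"
    proof (rule order_trans)
      have "0 \<le> (norm (J (A w) - \<tau> *\<^sub>R J w))\<^sup>2 / v" "0 \<le> freq w * (X_norm S w)\<^sup>2 / l"
        using v l freq_pos[OF z] by simp_all
      then show "\<Psi> l * ?b \<le> \<Psi> l * (X_norm S w)\<^sup>2"
        using Sigma_d_pos[OF \<Psi>, of l] by (intro mult_left_mono) auto
      show "\<Psi> l * (X_norm S w)\<^sup>2 \<le> \<Psi> (freq w) * (X_norm S w)\<^sup>2"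
        using Sigma_d_antimono[OF \<Psi> _ 4(2)] freq_pos[OF z] by (intro mult_right_mono) auto
    qed
    ultimately show ?thesis by linarith
  qed
qed

text \<open>
  The packets \<open>W n\<close> have total mass at least \<open>1 / 4\<close>, total defect over \<open>8 \<pi>\<^sup>2 / T\<^sup>2\<close> at most \<open>1 / 16\<close>, and
  total frequency over \<open>8 \<lambda>\<close> at most \<open>1 / 16\<close>, all relative to \<open>\<parallel>z\<parallel>\<^sup>2\<close>. Coercivity thus bounds their
  total output below by an eighth.
\<close>

lemma observability_comb:
  assumes coer: "spectrally_coercive_with D0 A0 D1 S lam \<phi> C0 \<epsilon> \<Psi>"
    and \<epsilon>: "\<epsilon> \<in> Sigma_d" and \<Psi>: "\<Psi> \<in> Sigma_d" and T: "T > 0" and F: "finite F"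
    and nz: "comb F a \<noteq> 0" and small: "8 * pi\<^sup>2 / T\<^sup>2 \<le> \<epsilon> (8 * freq (comb F a))"
  shows "T / 8 * \<Psi> (8 * freq (comb F a)) * (X_norm S (comb F a))\<^sup>2 \<le> energy T (comb F a)"
proof -
  let ?z = "comb F a"
  let ?\<tau> = "\<lambda>n::int. 2 * pi * of_int n / T"
  define l where "l = freq ?z"
  define N where "N = (X_norm S ?z)\<^sup>2"
  have l: "l > 0" unfolding l_def by (rule freq_pos) (use nz comb_DA in simp)
  obtain near where near: "\<And>k. \<bar>\<mu> k - ?\<tau> (near k)\<bar> \<le> pi / T"
    using choice[OF allI[OF exists_near_grid_frequency[OF T]], of \<mu>] by blast
  \<comment> \<open>one grid frequency near each eigenvalue already yields the lower bound on the mass\<close>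
  define G where "G = near ` (F - {0})"
  have G: "finite G" using F by (simp add: G_def)
  define W where "W n = comb F (\<lambda>k. window_transform T (\<mu> k - ?\<tau> n) * a k)" for n
  define P where "P k = (\<Sum>n\<in>G. (cmod (window_transform T (\<mu> k - ?\<tau> n)))\<^sup>2)" for k
  have P_lower: "1 / 4 \<le> P k" if "k \<in> F - {0}" for k
  proof -
    have "(1 / 2)\<^sup>2 \<le> (cmod (window_transform T (\<mu> k - ?\<tau> (near k))))\<^sup>2"
      by (intro power_mono window_transform_lower T near) simp
    also have "\<dots> \<le> P k" unfolding P_def
      by (rule member_le_sum) (use that G in \<open>auto simp: G_def\<close>)
    finally show ?thesis by (simp add: power2_eq_square)
  qed
  have P_upper: "P k \<le> 1 / 2" for k unfolding P_def by (rule window_transform_energy(1)[OF T G])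
  have N_eq: "N = (\<Sum>k\<in>F - {0}. (cmod (a k))\<^sup>2)" unfolding N_def by (rule X_norm_comb[OF F])
  have mass: "(\<Sum>n\<in>G. (X_norm S (W n))\<^sup>2) \<ge> N / 4"
  proof -
    have "(\<Sum>n\<in>G. (X_norm S (W n))\<^sup>2) = (\<Sum>k\<in>F - {0}. P k * (cmod (a k))\<^sup>2)"
      unfolding W_def X_norm_comb[OF F] P_def norm_mult power_mult_distrib sum_distrib_right
      by (rule sum.swap)
    also have "\<dots> \<ge> (\<Sum>k\<in>F - {0}. 1 / 4 * (cmod (a k))\<^sup>2)"
      by (intro sum_mono mult_right_mono P_lower) auto
    finally show ?thesis by (simp add: N_eq sum_divide_distrib)
  qed
  have freq_mass: "(\<Sum>n\<in>G. freq (W n) * (X_norm S (W n))\<^sup>2) \<le> l * N / 2"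
  proof -
    have "(\<Sum>n\<in>G. freq (W n) * (X_norm S (W n))\<^sup>2) = (\<Sum>k\<in>F - {0}. P k * (lam (nat \<bar>k\<bar>) * (cmod (a k))\<^sup>2))"
      unfolding W_def freq_comb[OF F] P_def norm_mult power_mult_distrib sum_distrib_right
      by (subst sum.swap) (simp add: mult_ac)
    also have "\<dots> \<le> (\<Sum>k\<in>F - {0}. 1 / 2 * (lam (nat \<bar>k\<bar>) * (cmod (a k))\<^sup>2))"
      by (intro sum_mono mult_right_mono P_upper mult_nonneg_nonneg less_imp_le[OF lam_pos]) auto
    also have "\<dots> = l * N / 2"
      unfolding l_def N_def freq_comb[OF F] by (simp add: sum_divide_distrib)
    finally show ?thesis .
  qed
  have defect: "(\<Sum>n\<in>G. (norm (J (A (W n)) - ?\<tau> n *\<^sub>R J (W n)))\<^sup>2) \<le> pi\<^sup>2 / (2 * T\<^sup>2) * N"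
  proof -
    have "(\<Sum>n\<in>G. (norm (J (A (W n)) - ?\<tau> n *\<^sub>R J (W n)))\<^sup>2)
        = (\<Sum>k\<in>F - {0}. (\<Sum>n\<in>G. (\<mu> k - ?\<tau> n)\<^sup>2 * (cmod (window_transform T (\<mu> k - ?\<tau> n)))\<^sup>2) * (cmod (a k))\<^sup>2)"
      unfolding W_def J_A_minus X_norm_J[symmetric] X_norm_comb[OF F] norm_mult power_mult_distrib
        norm_of_real power2_abs sum_distrib_right
      by (subst sum.swap) (simp add: mult_ac)
    also have "\<dots> \<le> (\<Sum>k\<in>F - {0}. pi\<^sup>2 / (2 * T\<^sup>2) * (cmod (a k))\<^sup>2)"
      by (intro sum_mono mult_right_mono window_transform_energy(2) T G) auto
    finally show ?thesis by (simp add: N_eq sum_distrib_left)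
  qed
  define v where "v = 8 * pi\<^sup>2 / T\<^sup>2"
  have v: "v > 0" "v \<le> \<epsilon> (8 * l)" using T small by (simp_all add: v_def l_def)
  have "N / 8 \<le> (\<Sum>n\<in>G. (X_norm S (W n))\<^sup>2 - (norm (J (A (W n)) - ?\<tau> n *\<^sub>R J (W n)))\<^sup>2 / v
      - freq (W n) * (X_norm S (W n))\<^sup>2 / (8 * l))"
  proof -
    have "(\<Sum>n\<in>G. (norm (J (A (W n)) - ?\<tau> n *\<^sub>R J (W n)))\<^sup>2) / v \<le> N / 16"
      using defect v(1) T by (simp add: v_def field_simps)
    moreover have "(\<Sum>n\<in>G. freq (W n) * (X_norm S (W n))\<^sup>2) / (8 * l) \<le> N / 16"
      using freq_mass l by (simp add: field_simps)
    ultimately show ?thesis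
      unfolding sum_subtractf sum_divide_distrib[symmetric] using mass by linarith
  qed
  then have "\<Psi> (8 * l) * (N / 8) \<le> \<Psi> (8 * l) * (\<Sum>n\<in>G. (X_norm S (W n))\<^sup>2
      - (norm (J (A (W n)) - ?\<tau> n *\<^sub>R J (W n)))\<^sup>2 / v - freq (W n) * (X_norm S (W n))\<^sup>2 / (8 * l))"
    by (rule mult_left_mono) (rule less_imp_le[OF Sigma_d_pos[OF \<Psi>]])
  also have "\<dots> \<le> (\<Sum>n\<in>G. (norm (C (W n)))\<^sup>2)"
    unfolding sum_distrib_left
    by (intro sum_mono coercive_packet_bound[OF coer \<epsilon> \<Psi> _ v]) (use l in \<open>auto simp: W_def comb_DA\<close>)
  finally have "T * (\<Psi> (8 * l) * (N / 8)) \<le> T * (\<Sum>n\<in>G. (norm (C (W n)))\<^sup>2)"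
    by (rule mult_left_mono) (use T in simp)
  also have "\<dots> \<le> energy T ?z"
    unfolding observed_energy_def W_def U_comb C_comb using F by (intro window_Bessel T G) simp
  finally show ?thesis by (simp add: l_def N_def mult_ac)
qed

text \<open>
  The strict inequality survives the passage to truncations of \<open>z\<close>.
\<close>

lemma observability:
  assumes coer: "spectrally_coercive_with D0 A0 D1 S lam \<phi> C0 \<epsilon> \<Psi>"
    and \<epsilon>: "\<epsilon> \<in> Sigma_d" and \<Psi>: "\<Psi> \<in> Sigma_d" and T: "T > 0"
    and z: "z \<in> DA - {0}" and small: "8 * pi\<^sup>2 / T\<^sup>2 < \<epsilon> (8 * freq z)"
  shows "T / 8 * \<Psi> (8 * freq z) * (X_norm S z)\<^sup>2 \<le> energy T z"
proof (rule tendsto_le[OF finite_subsets_at_top_neq_bot])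
  have z': "z \<in> DA" using z by simp
  have fr: "((\<lambda>F. 8 * freq (trunc z F)) \<longlongrightarrow> 8 * freq z) finsets"
    by (intro tendsto_mult tendsto_const freq_trunc z)
  show "((\<lambda>F. energy T (trunc z F)) \<longlongrightarrow> energy T z) finsets" by (rule energy_trunc[OF z'])
  show "((\<lambda>F. T / 8 * \<Psi> (8 * freq (trunc z F)) * (X_norm S (trunc z F))\<^sup>2)
      \<longlongrightarrow> T / 8 * \<Psi> (8 * freq z) * (X_norm S z)\<^sup>2) finsets"
    by (intro tendsto_mult tendsto_const tendsto_power X_norm_trunc isCont_tendsto_compose[OF Sigma_d_isCont[OF \<Psi>] fr])
  have "\<forall>\<^sub>F F in finsets. 8 * pi\<^sup>2 / T\<^sup>2 < \<epsilon> (8 * freq (trunc z F))"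
    by (rule order_tendstoD(1)[OF isCont_tendsto_compose[OF Sigma_d_isCont[OF \<epsilon>] fr] small])
  moreover have "\<forall>\<^sub>F F in finsets. 0 < X_norm S (trunc z F)"
    by (rule order_tendstoD(1)[OF X_norm_trunc X_norm_pos[OF z]])
  moreover have "\<forall>\<^sub>F F in finsets. finite F" by (rule eventually_finsets)
  ultimately show "\<forall>\<^sub>F F in finsets. T / 8 * \<Psi> (8 * freq (trunc z F)) * (X_norm S (trunc z F))\<^sup>2 \<le> energy T (trunc z F)"
  proof eventually_elim
    case (elim F)
    then have "trunc z F \<noteq> 0" using clinear_on_zero[OF J_clinear] by (auto simp: X_norm_J)
    then show ?case using elim by (intro observability_comb[OF coer \<epsilon> \<Psi> T]) auto
  qed
qed

text \<open>
  The state \<open>(0, \<phi>\<^sub>1)\<close> is the sum of eigenvectors for \<open>\<lambda>\<^sub>1\<close> and \<open>-\<lambda>\<^sub>1\<close>. Its output is zero, so coercivity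
  cannot apply to it, and its variance \<open>\<lambda>\<^sub>1\<^sup>2\<close> has to exceed the threshold.
\<close>

lemma coercivity_width_bound:
  assumes coer: "spectrally_coercive_with D0 A0 D1 S lam \<phi> C0 \<epsilon> \<Psi>" and \<Psi>: "\<Psi> \<in> Sigma_d"
  shows "\<epsilon> (lam 1) < (lam 1)\<^sup>2"
proof (rule ccontr)
  assume large: "\<not> \<epsilon> (lam 1) < (lam 1)\<^sup>2"
  define z where "z = (0 :: 'h, \<phi> 1)"
  have [simp]: "S 0 = 0" "A0 0 = 0" "C0 0 = 0"
    using C0 clinear_on_zero[OF S_clinear] clinear_on_zero[OF A0_clinear]
    by (auto simp: obs_bounded_def clinear_on_zero)
  have phi: "norm (\<phi> (Suc 0)) = 1"
    using cinner_self[of "\<phi> 1"] phi_orthonormal[of 1 1] by (simp add: abs_square_eq_1 del: of_real_power)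
  have zDA: "z \<in> DA"
    using phi_D1[of 1] D0_csubspace by (simp add: z_def A_dom_def csubspace_def)
  have nz: "z \<in> DA - {0}" using zDA phi by (auto simp: z_def zero_prod_def)
  have norm_z: "X_norm S z = 1" by (simp add: X_norm_def z_def phi)
  have "S ((- \<i>) *\<^sub>C \<phi> 1) = (- \<i>) *\<^sub>C S (\<phi> 1)"
    using S_clinear phi_D1[of 1] by (simp add: clinear_on_def)
  then have norm_Az: "X_norm S (A z) = lam 1"
    using lam_pos[of 1] by (simp add: X_norm_def z_def A_op_def scaleC_prod_def norm_scaleC S_phi phi)
  have mean: "freq_A A0 S z = 0"
    by (simp add: freq_A_def X_inner_def z_def A_op_def scaleC_prod_def)
  have "lam (nat \<bar>k\<bar>) * (cmod (coeff z k))\<^sup>2 = lam 1 * (cmod (coeff z k))\<^sup>2" if k: "k \<in> - {0}" for k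
  proof (cases "nat \<bar>k\<bar> = 1")
    case False
    then have "coeff z k = 0" using k by (simp add: coeff_eq z_def phi_orthonormal)
    then show ?thesis by simp
  qed simp
  then have "((\<lambda>k. lam (nat \<bar>k\<bar>) * (cmod (coeff z k))\<^sup>2) has_sum lam 1 * (X_norm S z)\<^sup>2) (- {0}) \<longleftrightarrow>
      ((\<lambda>k. lam 1 * (cmod (coeff z k))\<^sup>2) has_sum lam 1 * (X_norm S z)\<^sup>2) (- {0})"
    by (rule has_sum_cong)
  moreover have "((\<lambda>k. lam 1 * (cmod (coeff z k))\<^sup>2) has_sum lam 1 * (X_norm S z)\<^sup>2) (- {0})"
    by (intro has_sum_cmult_right Parseval)
  ultimately have "((\<lambda>k. lam (nat \<bar>k\<bar>) * (cmod (coeff z k))\<^sup>2) has_sum lam 1 * (X_norm S z)\<^sup>2) (- {0})"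
    by (rule iffD2)
  from has_sum_unique[OF freq_has_sum[OF zDA] this]
  have "freq z = lam 1" by (simp add: norm_z)
  then have "\<Psi> (lam 1) * (X_norm S z)\<^sup>2 \<le> (norm (C z))\<^sup>2"
    using coer nz large norm_z norm_Az mean unfolding spectrally_coercive_with_def by force
  then show False using Sigma_d_pos[OF \<Psi>, of "lam 1"] norm_z by (simp add: C_op_def z_def)
qed

text \<open>
  As \<open>\<epsilon>\<close> stays below \<open>\<lambda>\<^sub>1\<^sup>2\<close> on the relevant range, \<open>T \<epsilon> \<ge> \<theta>\<^sub>1\<close> yields \<open>T > \<theta>\<^sub>1 / \<lambda>\<^sub>1\<^sup>2\<close> and so
  \<open>T\<^sup>2 \<epsilon> > \<theta>\<^sub>1\<^sup>2 / \<lambda>\<^sub>1\<^sup>2\<close>. The value \<open>\<theta>\<^sub>1 = sqrt 8 \<pi> \<lambda>\<^sub>1\<close> makes this \<open>8 \<pi>\<^sup>2\<close>, and \<open>\<theta>\<^sub>2\<close> is an eighth of the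
  lower bound for \<open>T\<close>.
\<close>

lemma weak_obs_ineq_if_coercive:
  assumes coer: "spectrally_coercive_with D0 A0 D1 S lam \<phi> C0 \<epsilon> \<Psi>"
    and \<epsilon>: "\<epsilon> \<in> Sigma_d" and \<Psi>: "\<Psi> \<in> Sigma_d"
  shows "weak_obs_ineq D0 D1 S lam \<phi> C0 U \<epsilon> \<Psi> 8 (sqrt 8 * pi * lam 1) (sqrt 8 * pi / (8 * lam 1))"
  unfolding weak_obs_ineq_def
proof (intro ballI allI impI)
  fix z T assume z: "z \<in> DA - {0}" and TT: "obs_time \<epsilon> 8 (sqrt 8 * pi * lam 1) (freq z) \<le> T"
  let ?l = "freq z" and ?th = "sqrt 8 * pi * lam 1"
  have lam1: "lam 1 > 0" by (simp add: lam_pos)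
  then have th: "?th > 0" by simp
  have T: "T > 0"
    using TT obs_time_less_iff(3)[OF \<epsilon> _ th zero_less_one, of 8 ?l] by linarith
  have l: "lam 1 \<le> ?l" "0 < ?l" using freq_ge[OF z] freq_pos[OF z] by auto
  have eq: "?th \<le> T * \<epsilon> (8 * (1 / T + ?l))"
    using TT obs_time_less_iff(2)[OF \<epsilon> _ th T, of 8 ?l] l(2) by (simp add: not_less[symmetric])
  have "lam 1 \<le> 8 * (1 / T + ?l)" using l T by (simp add: add_increasing)
  then have "\<epsilon> (8 * (1 / T + ?l)) \<le> \<epsilon> (lam 1)" using lam1 by (intro Sigma_d_antimono[OF \<epsilon>]) auto
  also have "\<dots> < (lam 1)\<^sup>2" by (rule coercivity_width_bound[OF coer \<Psi>])
  finally have "T * \<epsilon> (8 * (1 / T + ?l)) < T * (lam 1)\<^sup>2" using T by simp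
  with eq have "?th < T * (lam 1)\<^sup>2" by linarith
  then have T_lower: "sqrt 8 * pi / lam 1 < T"
    using lam1 by (simp add: field_simps power2_eq_square)
  have "8 * pi\<^sup>2 = ?th * (sqrt 8 * pi / lam 1)" using lam1 by (simp add: power2_eq_square)
  also have "\<dots> < ?th * T" using T_lower th by (rule mult_strict_left_mono)
  also have "\<dots> \<le> T * \<epsilon> (8 * (1 / T + ?l)) * T" using eq T by (intro mult_right_mono) auto
  also have "\<dots> \<le> T * \<epsilon> (8 * ?l) * T"
    using T l by (intro mult_right_mono mult_left_mono Sigma_d_antimono[OF \<epsilon>]) auto
  finally have "8 * pi\<^sup>2 / T\<^sup>2 < \<epsilon> (8 * ?l)" using T by (simp add: field_simps power2_eq_square)
  from observability[OF coer \<epsilon> \<Psi> T z this]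
  have "T / 8 * \<Psi> (8 * ?l) * (X_norm S z)\<^sup>2 \<le> energy T z" .
  moreover have "sqrt 8 * pi / (8 * lam 1) * \<Psi> (8 * (1 / T + ?l)) \<le> T / 8 * \<Psi> (8 * ?l)"
    using T_lower T l by (intro mult_mono Sigma_d_antimono[OF \<Psi>]) (auto simp: less_imp_le[OF Sigma_d_pos[OF \<Psi>]] field_simps)
  then have "sqrt 8 * pi / (8 * lam 1) * \<Psi> (8 * (1 / T + ?l)) * (X_norm S z)\<^sup>2 \<le> T / 8 * \<Psi> (8 * ?l) * (X_norm S z)\<^sup>2"
    by (rule mult_right_mono) simp
  ultimately show "sqrt 8 * pi / (8 * lam 1) * \<Psi> (8 * (1 / T + ?l)) * (X_norm S z)\<^sup>2 \<le> energy T z" by linarith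
qed

text \<open>
  Take \<open>T\<close> to be the observation time. The term \<open>1 / T\<close> inside \<open>\<Psi>\<close> decreases with the frequency and
  would spoil monotonicity, so it is replaced by its largest value, at frequency 0.
\<close>

lemma weakly_observable_if_ineq:
  assumes \<epsilon>: "\<epsilon> \<in> Sigma_d" and \<Psi>: "\<Psi> \<in> Sigma_d" and th: "\<theta>0 > 0" "\<theta>1 > 0" "\<theta>2 > 0"
    and ineq: "weak_obs_ineq D0 D1 S lam \<phi> C0 U \<epsilon> \<Psi> \<theta>0 \<theta>1 \<theta>2"
  shows "weakly_observable D0 D1 S lam \<phi> C0 U"
proof -
  let ?T = "obs_time \<epsilon> \<theta>0 \<theta>1"
  define \<Psi>' where "\<Psi>' l = \<theta>2 * \<Psi> (\<theta>0 * (1 / ?T 0 + \<bar>l\<bar>))" for l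
  have T: "?T \<in> Sigma_i" by (rule obs_time_Sigma_i[OF \<epsilon> th(1,2)])
  have arg: "0 \<le> \<theta>0 * (1 / ?T 0 + \<bar>l\<bar>)" for l using th(1) Sigma_i_pos[OF T, of 0] by simp
  have "isCont \<Psi>' l" for l
    unfolding \<Psi>'_def by (intro continuous_intros isCont_o2[OF _ Sigma_d_isCont[OF \<Psi>]])
  moreover have "\<Psi>' y \<le> \<Psi>' x" if "0 \<le> x" "x \<le> y" for x y
    unfolding \<Psi>'_def using that th
    by (intro mult_left_mono Sigma_d_antimono[OF \<Psi> arg]) auto
  ultimately have \<Psi>': "\<Psi>' \<in> Sigma_d"
    using th(3) Sigma_d_pos[OF \<Psi>]
    unfolding Sigma_d_def by (auto simp: continuous_on_eq_continuous_at monotone_on_def \<Psi>'_def)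
  have "\<Psi>' (freq z) * (X_norm S z)\<^sup>2 \<le> energy (?T (freq z)) z" if z: "z \<in> DA - {0}" for z
  proof -
    have l: "0 \<le> freq z" using freq_pos[OF z] by simp
    have "1 / ?T (freq z) \<le> 1 / ?T 0"
      using Sigma_i_mono[OF T _ l] Sigma_i_pos[OF T, of 0] by (intro divide_left_mono) (auto intro: mult_pos_pos Sigma_i_pos[OF T])
    then have "\<Psi> (\<theta>0 * (1 / ?T 0 + freq z)) \<le> \<Psi> (\<theta>0 * (1 / ?T (freq z) + freq z))"
      using th(1) l Sigma_i_pos[OF T, of "freq z"] by (intro Sigma_d_antimono[OF \<Psi>]) auto
    then have "\<Psi>' (freq z) * (X_norm S z)\<^sup>2 \<le> \<theta>2 * \<Psi> (\<theta>0 * (1 / ?T (freq z) + freq z)) * (X_norm S z)\<^sup>2"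
      using l th(3) by (simp add: \<Psi>'_def mult_right_mono)
    also have "\<dots> \<le> energy (?T (freq z)) z"
      using ineq z unfolding weak_obs_ineq_def by blast
    finally show ?thesis .
  qed
  then show ?thesis unfolding weakly_observable_def using T \<Psi>' by blast
qed

end

section \<open>The equivalence\<close>

theorem theorem2p2:
  fixes A0 S :: "'h::complex_hilbert \<Rightarrow> 'h" and D0 D1 :: "'h set"
    and lam :: "nat \<Rightarrow> real" and \<phi> :: "nat \<Rightarrow> 'h"
    and C0 :: "'h \<Rightarrow> 'y::complex_hilbert"
    and U :: "real \<Rightarrow> 'h \<times> 'h \<Rightarrow> 'h \<times> 'h"
  assumes A0: "self_adjoint D0 A0" "positive_on D0 A0" "compact_resolvent D0 A0"
    and S: "operator_sqrt D0 A0 D1 S"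
    and basis: "eigenbasis D1 S lam \<phi>"
    and C0: "obs_bounded D0 A0 C0"
    and U: "isometry_group_generated_by D0 A0 D1 S U"
    and adm: "admissible D0 D1 S C0 U"
  shows "(weakly_observable D0 D1 S lam \<phi> C0 U \<longleftrightarrow> spectrally_coercive D0 A0 D1 S lam \<phi> C0)
    \<and> (spectrally_coercive D0 A0 D1 S lam \<phi> C0 \<longleftrightarrow>
        (\<exists>\<epsilon>\<in>Sigma_d. \<exists>\<Psi>\<in>Sigma_d. \<exists>\<theta>0>0. \<exists>\<theta>1>0. \<exists>\<theta>2>0.
          weak_obs_ineq D0 D1 S lam \<phi> C0 U \<epsilon> \<Psi> \<theta>0 \<theta>1 \<theta>2))
    \<and> (\<exists>\<theta>0>0. \<exists>\<theta>1>0. \<exists>\<theta>2>0. \<forall>\<epsilon>\<in>Sigma_d. \<forall>\<Psi>\<in>Sigma_d.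
        spectrally_coercive_with D0 A0 D1 S lam \<phi> C0 \<epsilon> \<Psi> \<longrightarrow>
        weak_obs_ineq D0 D1 S lam \<phi> C0 U \<epsilon> \<Psi> \<theta>0 \<theta>1 \<theta>2)
    \<and> (\<forall>\<epsilon>\<in>Sigma_d. \<forall>\<theta>0>0. \<forall>\<theta>1>0.
        (\<forall>l\<ge>0. \<exists>!T. obs_time_eq \<epsilon> \<theta>0 \<theta>1 l T) \<and> obs_time \<epsilon> \<theta>0 \<theta>1 \<in> Sigma_i)"
proof -
  interpret wave_system A0 S D0 D1 lam \<phi> C0 U
    using assms by unfold_locales
  define \<theta>1 where "\<theta>1 = sqrt 8 * pi * lam 1"
  define \<theta>2 where "\<theta>2 = sqrt 8 * pi / (8 * lam 1)"
  have th: "(8::real) > 0" "\<theta>1 > 0" "\<theta>2 > 0"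
    using lam_pos[of 1] by (simp_all add: \<theta>1_def \<theta>2_def)
  have ineq: "weak_obs_ineq D0 D1 S lam \<phi> C0 U \<epsilon> \<Psi> 8 \<theta>1 \<theta>2"
    if "\<epsilon> \<in> Sigma_d" "\<Psi> \<in> Sigma_d" "spectrally_coercive_with D0 A0 D1 S lam \<phi> C0 \<epsilon> \<Psi>" for \<epsilon> \<Psi>
    unfolding \<theta>1_def \<theta>2_def using that by (intro weak_obs_ineq_if_coercive)
  have part3: "\<exists>\<theta>0>0. \<exists>\<theta>1>0. \<exists>\<theta>2>0. \<forall>\<epsilon>\<in>Sigma_d. \<forall>\<Psi>\<in>Sigma_d.
        spectrally_coercive_with D0 A0 D1 S lam \<phi> C0 \<epsilon> \<Psi> \<longrightarrow>
        weak_obs_ineq D0 D1 S lam \<phi> C0 U \<epsilon> \<Psi> \<theta>0 \<theta>1 \<theta>2"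
    using th ineq by blast
  have coercive_ineq: "\<exists>\<epsilon>\<in>Sigma_d. \<exists>\<Psi>\<in>Sigma_d. \<exists>\<theta>0>0. \<exists>\<theta>1>0. \<exists>\<theta>2>0.
          weak_obs_ineq D0 D1 S lam \<phi> C0 U \<epsilon> \<Psi> \<theta>0 \<theta>1 \<theta>2"
    if "spectrally_coercive D0 A0 D1 S lam \<phi> C0"
    using that th ineq unfolding spectrally_coercive_def by meson
  have ineq_observable: "weakly_observable D0 D1 S lam \<phi> C0 U"
    if "\<exists>\<epsilon>\<in>Sigma_d. \<exists>\<Psi>\<in>Sigma_d. \<exists>\<theta>0>0. \<exists>\<theta>1>0. \<exists>\<theta>2>0.
          weak_obs_ineq D0 D1 S lam \<phi> C0 U \<epsilon> \<Psi> \<theta>0 \<theta>1 \<theta>2"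
    using that weakly_observable_if_ineq by blast
  have time: "\<forall>\<epsilon>\<in>Sigma_d. \<forall>\<theta>0>0. \<forall>\<theta>1>0.
        (\<forall>l\<ge>0. \<exists>!T. obs_time_eq \<epsilon> \<theta>0 \<theta>1 l T) \<and> obs_time \<epsilon> \<theta>0 \<theta>1 \<in> Sigma_i"
    by (intro ballI allI impI conjI obs_time_exists_unique obs_time_Sigma_i)
  show ?thesis
    using spectrally_coercive_if_weakly_observable coercive_ineq ineq_observable part3 time
    by blast
qed

end
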